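(* Let $G(n,p)$ be the Erdős–Rényi random graph on vertex set $\{1,\dots,n\}$ in which each pair is an edge independently with probability $p=p(n)$. (i) If $\frac{1}{2n}\le p(n)\le \frac{1}{e^6}\sqrt{\frac{\log n}{n}}$, then asymptotically almost surely $\mathrm{ISO}(G(n,p))=\Theta\!\left(n\cdot\frac{\log n}{\log\gamma(n)}\right)$, where $\gamma(n)=\frac{1}{p}\sqrt{\frac{\log n}{n}}$. (ii) If $p(n)>\frac{1}{e^6}\sqrt{\frac{\log n}{n}}$, then asymptotically almost surely $\mathrm{ISO}(G(n,p))=\Theta(n^2p^2)$.
   Context: For a graph $G$, $\mathrm{ISO}(G)$ is the largest integer $s$ such that $G$ contains a pair of edge-disjoint isomorphic subgraphs with $s$ edges each. A property holds asymptotically almost surely (a.a.s.) if its probability tends to $1$ as $n\to\infty$. $f=\Theta(g)$ means there are positive constants $c_1,c_2$ with $c_1 g\le f\le c_2 g$ for all large $n$. Logarithms are natural. *)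

theory Defs
  imports "HOL-Probability.Probability" "HOL-Probability.Product_PMF"
begin

definition pairs :: "'a set \<Rightarrow> 'a set set" where
  "pairs V = {e. e \<subseteq> V \<and> card e = 2}"

type_synonym 'a graph = "'a set \<times> 'a set set"

definition subgraph :: "'a graph \<Rightarrow> 'a graph \<Rightarrow> bool" where
  "subgraph H G \<longleftrightarrow> fst H \<subseteq> fst G \<and> snd H \<subseteq> snd G \<and> snd H \<subseteq> pairs (fst H)"

definition isomorphic :: "'a graph \<Rightarrow> 'b graph \<Rightarrow> bool" where
  "isomorphic G H \<longleftrightarrow> (\<exists>f. bij_betw f (fst G) (fst H) \<and>
     (\<forall>u\<in>fst G. \<forall>v\<in>fst G. {u, v} \<in> snd G \<longleftrightarrow> {f u, f v} \<in> snd H))"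

definition has_iso_pair :: "'a graph \<Rightarrow> nat \<Rightarrow> bool" where
  "has_iso_pair G s \<longleftrightarrow> (\<exists>H1 H2. subgraph H1 G \<and> subgraph H2 G \<and>
     snd H1 \<inter> snd H2 = {} \<and> isomorphic H1 H2 \<and>
     card (snd H1) = s \<and> card (snd H2) = s)"

definition ISO :: "'a graph \<Rightarrow> nat" where
  "ISO G = Max {s. has_iso_pair G s}"

text \<open>For a finite edge set, the maximum above is taken over a finite nonempty set.\<close>

lemma has_iso_pair_0: "has_iso_pair G 0"
proof -
  have "subgraph ({}, {}) G" "isomorphic ({}, {}) ({}, {})"
    by (auto simp: subgraph_def isomorphic_def bij_betw_def)
  then show ?thesis
    unfolding has_iso_pair_def by (intro exI[of _ "({}, {})"]) simp
qed

lemma has_iso_pair_le: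
  assumes "finite (snd G)" "has_iso_pair G s"
  shows "s \<le> card (snd G)"
  using assms by (auto simp: has_iso_pair_def subgraph_def intro: card_mono)

lemma
  assumes "finite (snd G)"
  shows has_iso_pair_ISO: "has_iso_pair G (ISO G)"
    and ISO_greatest: "has_iso_pair G s \<Longrightarrow> s \<le> ISO G"
proof -
  have fin: "finite {s. has_iso_pair G s}"
    by (rule finite_subset[of _ "{..card (snd G)}"]) (auto dest: has_iso_pair_le[OF assms])
  have "ISO G \<in> {s. has_iso_pair G s}"
    unfolding ISO_def by (rule Max_in[OF fin]) (use has_iso_pair_0 in blast)
  then show "has_iso_pair G (ISO G)" by simp
  show "has_iso_pair G s \<Longrightarrow> s \<le> ISO G"
    unfolding ISO_def by (rule Max_ge[OF fin]) simp
qed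

text \<open>\<open>b e\<close> is the indicator of the pair \<open>e\<close> being an edge; the product pmf makes these
  indicators independent over all pairs.\<close>

definition random_graph :: "nat \<Rightarrow> real \<Rightarrow> nat graph pmf" where
  "random_graph n p =
     map_pmf (\<lambda>b. ({1..n}, {e \<in> pairs {1..n}. b e}))
       (Pi_pmf (pairs {1..n}) False (\<lambda>_. bernoulli_pmf p))"

definition aas :: "(nat \<Rightarrow> 'a pmf) \<Rightarrow> (nat \<Rightarrow> 'a \<Rightarrow> bool) \<Rightarrow> bool" where
  "aas M P \<longleftrightarrow> (\<lambda>n. measure_pmf.prob (M n) {x. P n x}) \<longlonglongrightarrow> 1"

text \<open>The constants are deterministic: they may depend on \<open>M\<close> and \<open>f\<close>, but neither on \<open>n\<close>
  nor on the outcome.\<close>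

definition aas_Theta :: "(nat \<Rightarrow> 'a pmf) \<Rightarrow> ('a \<Rightarrow> real) \<Rightarrow> (nat \<Rightarrow> real) \<Rightarrow> bool" where
  "aas_Theta M X f \<longleftrightarrow>
     (\<exists>c1>0. \<exists>c2>0. aas M (\<lambda>n x. c1 * f n \<le> X x \<and> X x \<le> c2 * f n))"

end

(* Upper bounds: two edge-disjoint isomorphic subgraphs with s edges give a map phi on the vertices
   and an edge set S of size s with S and phi S disjoint, all of whose 2s pairs are edges. A union
   bound over the n^n maps and the choices of S gives n^n (e n^2 p^2 / (2s))^s, which is small for
   s of the claimed order.

   Lower bound in (ii): the translation by n/2 maps the pairs inside the first half of the vertices
   to pairs inside the second half; the number of pairs that are edges together with their image is
   binomial with mean about n^2 p^2 / 8.

   Lower bound in (i), gamma > n^(1/20): the claimed order is n, and two halves of a linear-sized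
   matching suffice.

   Lower bound in (i), gamma <= n^(1/20): fix a bijection f from A to B and look for a matching
   between two further vertex sets X and Y such that matched vertices x and g x have at least
   k = floor (log n / (20 log gamma)) common neighbours under f; the stars of these sizes around x
   and g x are then isomorphic. A given pair (x, y) qualifies with probability at least n^(-1/6).
   Splitting X into blocks of size n^(1/5) and using only neighbours that are private within a
   block makes enough of these events independent for a union bound over all pairs of subsets,
   which shows that every maximal matching is large. *)

theory Submission
  imports Defs "HOL-Real_Asymp.Real_Asymp"
begin

section \<open>Independent bits: resampling, independence and concentration\<close>

definition bits :: "'i set \<Rightarrow> real \<Rightarrow> ('i \<Rightarrow> bool) pmf" where
  "bits I p = Pi_pmf I False (\<lambda>_. bernoulli_pmf p)"

abbreviation bit_prob :: "'i set \<Rightarrow> real \<Rightarrow> (('i \<Rightarrow> bool) \<Rightarrow> bool) \<Rightarrow> real" where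
  "bit_prob I p Q \<equiv> measure_pmf.prob (bits I p) {b. Q b}"

text \<open>Plays the role of measurability with respect to the coordinates in \<open>S\<close>. The
  condition ranges over all \<open>b\<close>, not only those in the support, so it can be applied to
  merged outcomes directly.\<close>

definition depends_on :: "(('i \<Rightarrow> bool) \<Rightarrow> 'c) \<Rightarrow> 'i set \<Rightarrow> bool" where
  "depends_on f S \<longleftrightarrow> (\<forall>b b'. (\<forall>i\<in>S. b i = b' i) \<longrightarrow> f b = f b')"

definition merge_bits :: "'i set \<Rightarrow> ('i \<Rightarrow> bool) \<Rightarrow> ('i \<Rightarrow> bool) \<Rightarrow> 'i \<Rightarrow> bool" where
  "merge_bits S b0 b = (\<lambda>i. if i \<in> S then b0 i else b i)"

lemma depends_onD: "depends_on f S \<Longrightarrow> (\<And>i. i \<in> S \<Longrightarrow> b i = b' i) \<Longrightarrow> f b = f b'"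
  by (auto simp: depends_on_def)

lemma depends_on_comp: "depends_on f S \<Longrightarrow> depends_on (\<lambda>b. g (f b)) S"
  unfolding depends_on_def by metis

lemma finite_set_bits [simp]: "finite I \<Longrightarrow> finite (set_pmf (bits I p))"
  unfolding bits_def
  by (rule finite_subset[OF set_Pi_pmf_subset']) (auto intro: finite_PiE_dflt)

lemma integrable_bits [simp]: "finite I \<Longrightarrow> integrable (bits I p) (f :: _ \<Rightarrow> real)"
  by (intro integrable_measure_pmf_finite) simp

text \<open>Resampling the bits outside \<open>S\<close> does not change the distribution; this replaces both
  conditioning on the bits in \<open>S\<close> and Fubini's theorem for the product measure.\<close>

lemma bits_resample:
  assumes "finite I"
  shows "bits I p = bind_pmf (bits I p) (\<lambda>b0. map_pmf (merge_bits S b0) (bits I p))"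
proof -
  let ?B = "bernoulli_pmf p"
  \<comment> \<open>One coordinate: drawing two independent copies and keeping a prescribed one of
    them is again Bernoulli. \<open>Pi_pmf_bind\<close> lifts this to the product.\<close>
  have *: "bind_pmf ?B (\<lambda>x. bind_pmf ?B (\<lambda>y. return_pmf (if i \<in> S then x else y))) = ?B" for i
    by (cases "i \<in> S") (simp_all add: bind_return_pmf')
  have "bits I p = Pi_pmf I False (\<lambda>i. bind_pmf ?B (\<lambda>x. bind_pmf ?B (\<lambda>y. return_pmf (if i \<in> S then x else y))))"
    unfolding bits_def * ..
  also have "\<dots> = bind_pmf (bits I p) (\<lambda>b0. bind_pmf (bits I p) (\<lambda>b.
       return_pmf (\<lambda>i. if i \<in> I then (if i \<in> S then b0 i else b i) else False)))"
    unfolding bits_def using assms by (simp add: Pi_pmf_bind[where d' = False])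
  also have "\<dots> = bind_pmf (bits I p) (\<lambda>b0. map_pmf (merge_bits S b0) (bits I p))"
    unfolding map_pmf_def
  proof (intro bind_pmf_cong refl)
    fix b0 b assume "b0 \<in> set_pmf (bits I p)" "b \<in> set_pmf (bits I p)"
    then have "\<forall>i. i \<notin> I \<longrightarrow> \<not> b0 i \<and> \<not> b i"
      using set_Pi_pmf_subset[OF assms] unfolding bits_def by fastforce
    then show "return_pmf (\<lambda>i. if i \<in> I then (if i \<in> S then b0 i else b i) else False)
        = return_pmf (merge_bits S b0 b)"
      by (auto simp: merge_bits_def fun_eq_iff)
  qed
  finally show ?thesis .
qed

lemma expectation_resample:
  fixes f :: "('i \<Rightarrow> bool) \<Rightarrow> real"
  assumes "finite I"
  shows "measure_pmf.expectation (bits I p) f =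
    measure_pmf.expectation (bits I p) (\<lambda>b0. measure_pmf.expectation (bits I p) (\<lambda>b. f (merge_bits S b0 b)))"
proof -
  let ?A = "set_pmf (bits I p)"
  have "measure_pmf.expectation (bits I p) f = (\<Sum>a\<in>?A. pmf (bits I p) a *
      measure_pmf.expectation (bits I p) (\<lambda>b. f (merge_bits S a b)))"
    by (subst bits_resample[OF assms, where S = S], subst pmf_expectation_bind[where A = ?A]) (use assms in auto)
  also have "\<dots> = measure_pmf.expectation (bits I p)
      (\<lambda>b0. measure_pmf.expectation (bits I p) (\<lambda>b. f (merge_bits S b0 b)))"
    by (subst integral_measure_pmf[where A = ?A]) (use assms in auto)
  finally show ?thesis .
qed

lemma bit_prob_expectation:
  "bit_prob I p Q = measure_pmf.expectation (bits I p) (\<lambda>b. of_bool (Q b))"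
proof -
  have "bit_prob I p Q = measure_pmf.expectation (bits I p) (indicator {b. Q b})" by simp
  also have "indicator {b. Q b} = (\<lambda>b. of_bool (Q b) :: real)" by (auto simp: indicator_def)
  finally show ?thesis .
qed

lemma bit_prob_resample_le:
  assumes "finite I" "depends_on H S" "0 \<le> \<delta>"
    and le: "\<And>b0. H b0 \<Longrightarrow> bit_prob I p (\<lambda>b. Q (merge_bits S b0 b)) \<le> \<delta>"
  shows "bit_prob I p (\<lambda>b. H b \<and> Q b) \<le> \<delta>"
proof -
  have "bit_prob I p (\<lambda>b. H b \<and> Q b) = measure_pmf.expectation (bits I p) (\<lambda>b0.
      bit_prob I p (\<lambda>b. H (merge_bits S b0 b) \<and> Q (merge_bits S b0 b)))"
    unfolding bit_prob_expectation by (rule expectation_resample[OF assms(1)])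
  also have "\<dots> \<le> measure_pmf.expectation (bits I p) (\<lambda>b0. \<delta>)"
  proof (rule integral_mono)
    fix b0
    have "H (merge_bits S b0 b) = H b0" for b
      by (rule depends_onD[OF assms(2)]) (simp add: merge_bits_def)
    then show "bit_prob I p (\<lambda>b. H (merge_bits S b0 b) \<and> Q (merge_bits S b0 b)) \<le> \<delta>"
      using le[of b0] \<open>0 \<le> \<delta>\<close> by (cases "H b0") simp_all
  qed (use assms in auto)
  finally show ?thesis by simp
qed

lemma expectation_mult_bits:
  fixes f g :: "('i \<Rightarrow> bool) \<Rightarrow> real"
  assumes "finite I" "depends_on f S" "depends_on g T" "S \<inter> T = {}"
  shows "measure_pmf.expectation (bits I p) (\<lambda>b. f b * g b) =
    measure_pmf.expectation (bits I p) f * measure_pmf.expectation (bits I p) g"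
proof -
  have "f (merge_bits S b0 b) = f b0" for b0 b
    by (rule depends_onD[OF assms(2)]) (simp add: merge_bits_def)
  moreover have "g (merge_bits S b0 b) = g b" for b0 b
    by (rule depends_onD[OF assms(3)]) (use assms(4) in \<open>auto simp: merge_bits_def\<close>)
  ultimately show ?thesis
    by (subst expectation_resample[OF assms(1), where S = S]) simp
qed

lemma expectation_prod_bits:
  fixes f :: "'j \<Rightarrow> ('i \<Rightarrow> bool) \<Rightarrow> real"
  assumes "finite I" "finite J" "\<And>j. j \<in> J \<Longrightarrow> depends_on (f j) (S j)" "disjoint_family_on S J"
  shows "measure_pmf.expectation (bits I p) (\<lambda>b. \<Prod>j\<in>J. f j b) =
    (\<Prod>j\<in>J. measure_pmf.expectation (bits I p) (f j))"
  using assms(2-)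
proof (induction J rule: finite_induct)
  case (insert j J)
  have "depends_on (\<lambda>b. \<Prod>j\<in>J. f j b) (\<Union>j\<in>J. S j)"
    unfolding depends_on_def
    by (intro allI impI prod.cong refl depends_onD[OF insert.prems(1)]) auto
  moreover have "S j \<inter> (\<Union>j\<in>J. S j) = {}"
    using insert.prems(2) insert.hyps by (fastforce simp: disjoint_family_on_def)
  ultimately have "measure_pmf.expectation (bits I p) (\<lambda>b. f j b * (\<Prod>j\<in>J. f j b)) =
      measure_pmf.expectation (bits I p) (f j) * measure_pmf.expectation (bits I p) (\<lambda>b. \<Prod>j\<in>J. f j b)"
    by (intro expectation_mult_bits[OF assms(1) insert.prems(1)]) auto
  then show ?case
    using insert by (simp add: disjoint_family_on_def)
qed simp

lemma bit_prob_Ball: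
  assumes "finite I" "finite J" "\<And>j. j \<in> J \<Longrightarrow> depends_on (Q j) (S j)" "disjoint_family_on S J"
  shows "bit_prob I p (\<lambda>b. \<forall>j\<in>J. Q j b) = (\<Prod>j\<in>J. bit_prob I p (Q j))"
proof -
  have "bit_prob I p (\<lambda>b. \<forall>j\<in>J. Q j b) = measure_pmf.expectation (bits I p) (\<lambda>b. \<Prod>j\<in>J. of_bool (Q j b))"
    unfolding bit_prob_expectation
    by (rule Bochner_Integration.integral_cong[OF refl]) (use assms(2) in auto)
  also have "\<dots> = (\<Prod>j\<in>J. bit_prob I p (Q j))"
    unfolding bit_prob_expectation using assms
    by (intro expectation_prod_bits[where S = S] depends_on_comp[where g = of_bool]) auto
  finally show ?thesis .
qed

lemma bit_prob_single:
  assumes "finite I" "i \<in> I" "0 \<le> p" "p \<le> 1"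
  shows "bit_prob I p (\<lambda>b. b i) = p" "bit_prob I p (\<lambda>b. \<not> b i) = 1 - p"
proof -
  have B: "map_pmf (\<lambda>b. b i) (bits I p) = bernoulli_pmf p"
    unfolding bits_def using assms by (simp add: Pi_pmf_component)
  have *: "bit_prob I p (\<lambda>b. b i = t) = pmf (bernoulli_pmf p) t" for t
    unfolding B[symmetric] by (simp add: pmf_map vimage_def)
  show "bit_prob I p (\<lambda>b. b i) = p" "bit_prob I p (\<lambda>b. \<not> b i) = 1 - p"
    using *[of True] *[of False] assms by simp_all
qed

lemma bit_prob_all_ones:
  assumes "finite I" "T \<subseteq> I" "0 \<le> p" "p \<le> 1"
  shows "bit_prob I p (\<lambda>b. \<forall>i\<in>T. b i) = p ^ card T"
proof -
  have "bit_prob I p (\<lambda>b. \<forall>i\<in>T. b i) = (\<Prod>i\<in>T. bit_prob I p (\<lambda>b. b i))"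
    using assms finite_subset
    by (intro bit_prob_Ball[where S = "\<lambda>i. {i}"]) (auto simp: depends_on_def disjoint_family_on_def)
  then show ?thesis using assms by (simp add: bit_prob_single subset_iff)
qed

lemma bit_prob_all_zeros:
  assumes "finite I" "T \<subseteq> I" "0 \<le> p" "p \<le> 1"
  shows "bit_prob I p (\<lambda>b. \<forall>i\<in>T. \<not> b i) = (1 - p) ^ card T"
proof -
  have "bit_prob I p (\<lambda>b. \<forall>i\<in>T. \<not> b i) = (\<Prod>i\<in>T. bit_prob I p (\<lambda>b. \<not> b i))"
    using assms finite_subset
    by (intro bit_prob_Ball[where S = "\<lambda>i. {i}"]) (auto simp: depends_on_def disjoint_family_on_def)
  then show ?thesis using assms by (simp add: bit_prob_single subset_iff)
qed

lemma bit_prob_union_bound: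
  assumes "finite T" "\<And>t. t \<in> T \<Longrightarrow> bit_prob I p (Q t) \<le> \<delta>"
  shows "bit_prob I p (\<lambda>b. \<exists>t\<in>T. Q t b) \<le> real (card T) * \<delta>"
proof -
  have "{b. \<exists>t\<in>T. Q t b} = (\<Union>t\<in>T. {b. Q t b})" by auto
  then have "bit_prob I p (\<lambda>b. \<exists>t\<in>T. Q t b) \<le> (\<Sum>t\<in>T. bit_prob I p (Q t))"
    using measure_pmf.finite_measure_subadditive_finite[of T "\<lambda>t. {b. Q t b}" "bits I p"] assms(1) by simp
  also have "\<dots> \<le> real (card T) * \<delta>"
    using assms(2) by (intro sum_bounded_above)
  finally show ?thesis .
qed

lemma bit_prob_mono:
  assumes "\<And>b. Q b \<Longrightarrow> Q' b"
  shows "bit_prob I p Q \<le> bit_prob I p Q'"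
  by (rule measure_pmf.finite_measure_mono) (use assms in auto)

lemma exp_minus1_le: "exp (- 1) \<le> (2 / 5 :: real)"
proof -
  have "5 / 2 \<le> exp (1 :: real)"
    using exp_lower_Taylor_quadratic[of 1] by simp
  then show ?thesis by (simp add: exp_minus field_simps)
qed

text \<open>Markov's inequality for \<open>exp (- N)\<close>, where \<open>N\<close> counts the events that occur.\<close>

lemma bit_prob_Chernoff:
  fixes q :: real
  assumes "finite I" "finite J" "\<And>j. j \<in> J \<Longrightarrow> depends_on (Q j) (S j)" "disjoint_family_on S J"
    and q: "\<And>j. j \<in> J \<Longrightarrow> q \<le> bit_prob I p (Q j)"
  shows "bit_prob I p (\<lambda>b. real (card {j \<in> J. Q j b}) \<le> q * card J / 4) \<le> exp (- q * card J / 4)"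
proof -
  define N where "N b = real (card {j \<in> J. Q j b})" for b
  define f where "f j b = exp (- (of_bool (Q j b) :: real))" for j b
  define t where "t = q * card J / 4"
  have N: "exp (- N b) = (\<Prod>j\<in>J. f j b)" for b  
  proof -
    have "N b = (\<Sum>j\<in>J. of_bool (Q j b))"
      unfolding N_def using assms(2) by (simp add: Int_def)
    then show ?thesis
      unfolding f_def using assms(2) by (simp add: exp_sum[symmetric] sum_negf del: sum_of_bool_eq)
  qed
  have f1: "measure_pmf.expectation (bits I p) (f j) \<le> exp (- q / 2)" if "j \<in> J" for j
  proof -
    have qP: "q \<le> bit_prob I p (Q j)" and P1: "bit_prob I p (Q j) \<le> 1" using q[OF that] by auto
    have "f j = (\<lambda>b. 1 - (1 - exp (- 1)) * of_bool (Q j b))"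
      by (auto simp: f_def)
    then have "measure_pmf.expectation (bits I p) (f j) = 1 - (1 - exp (- 1)) * bit_prob I p (Q j)"
      using assms(1) by (simp add: bit_prob_expectation)
    \<comment> \<open>Uses 1 - 1/e >= 1/2.\<close>
    also have "\<dots> \<le> 1 - (1 / 2) * bit_prob I p (Q j)"
      using exp_minus1_le by (intro diff_left_mono mult_right_mono) auto
    also have "\<dots> \<le> 1 + (- q / 2)" using qP by simp
    also have "\<dots> \<le> exp (- q / 2)" by (rule exp_ge_add_one_self)
    finally show ?thesis .
  qed
  \<comment> \<open>Markov's inequality. The threshold contributes exp (q |J| / 4) and the product
    at most exp (- q |J| / 2), which leaves exp (- q |J| / 4).\<close>
  have "bit_prob I p (\<lambda>b. N b \<le> t) \<le> measure_pmf.expectation (bits I p) (\<lambda>b. exp t * exp (- N b))"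
    unfolding bit_prob_expectation
    by (rule integral_mono) (use assms(1) in \<open>auto simp: exp_add[symmetric]\<close>)
  also have "\<dots> = exp t * measure_pmf.expectation (bits I p) (\<lambda>b. \<Prod>j\<in>J. f j b)"
    by (simp add: N)
  also have "measure_pmf.expectation (bits I p) (\<lambda>b. \<Prod>j\<in>J. f j b) = (\<Prod>j\<in>J. measure_pmf.expectation (bits I p) (f j))"
    using assms(1-4)
    unfolding f_def
    by (intro expectation_prod_bits[where S = S] depends_on_comp[where g = "\<lambda>x. exp (- of_bool x)"]) auto
  also have "\<dots> \<le> (\<Prod>j\<in>J. exp (- q / 2))"
    using f1 by (intro prod_mono) (auto simp: f_def)
  also have "exp t * (\<Prod>j\<in>J. exp (- q / 2)) = exp (t + card J * (- q / 2))"
    unfolding exp_add exp_of_nat_mult by simp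
  also have "t + card J * (- q / 2) = - q * card J / 4" by (simp add: t_def field_simps)
  finally show ?thesis by (simp add: N_def t_def)
qed

section \<open>The random graph as bits, and certificates for \<open>ISO\<close>\<close>

definition graph_of_bits :: "nat \<Rightarrow> (nat set \<Rightarrow> bool) \<Rightarrow> nat graph" where
  "graph_of_bits n b = ({1..n}, {e \<in> pairs {1..n}. b e})"

lemma finite_pairs [simp]: "finite V \<Longrightarrow> finite (pairs V)"
  by (rule finite_subset[of _ "Pow V"]) (auto simp: pairs_def)

lemma pair_mem_pairs [simp]: "{u, v} \<in> pairs V \<longleftrightarrow> u \<in> V \<and> v \<in> V \<and> u \<noteq> v"
  by (auto simp: pairs_def card_insert_if)

lemma pairsE:
  assumes "e \<in> pairs V"
  obtains u v where "e = {u, v}" "u \<in> V" "v \<in> V" "u \<noteq> v"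
  using assms by (auto simp: pairs_def card_2_iff)

lemma card_pairs: "finite V \<Longrightarrow> card (pairs V) = card V choose 2"
  unfolding pairs_def by (rule n_subsets)

lemma finite_graph_of_bits [simp]: "finite (snd (graph_of_bits n b))"
  by (simp add: graph_of_bits_def)

text \<open>Produces the data counted in the union bound for the upper tail. An isomorphism is only
  defined on the vertices of the first subgraph; making it a map from \<open>V\<close> to itself
  leaves at most |V|^|V| candidates.\<close>

lemma has_iso_pair_imp_map:
  assumes "has_iso_pair (V, E) s"
  obtains \<phi> S where "\<phi> \<in> V \<rightarrow>\<^sub>E V" "S \<subseteq> pairs V" "S \<subseteq> E" "(`) \<phi> ` S \<subseteq> E"
    "S \<inter> (`) \<phi> ` S = {}" "card S = s" "inj_on ((`) \<phi>) S"
proof -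
  from assms obtain V1 E1 V2 E2 f where H:
    "V1 \<subseteq> V" "E1 \<subseteq> E" "E1 \<subseteq> pairs V1" "V2 \<subseteq> V" "E2 \<subseteq> E" "E2 \<subseteq> pairs V2"
    "E1 \<inter> E2 = {}" "card E1 = s" "bij_betw f V1 V2"
    "\<And>u v. u \<in> V1 \<Longrightarrow> v \<in> V1 \<Longrightarrow> {u, v} \<in> E1 \<longleftrightarrow> {f u, f v} \<in> E2"
    unfolding has_iso_pair_def isomorphic_def subgraph_def by force
  \<comment> \<open>The identity off \<open>V1\<close> keeps the values in \<open>V\<close>;
    \<open>undefined\<close> off \<open>V\<close> is what the extensional function space
    requires.\<close>
  define \<phi> where "\<phi> = (\<lambda>v. if v \<in> V then if v \<in> V1 then f v else v else undefined)"
  have \<phi>: "\<phi> v = f v" if "v \<in> V1" for v using that H(1) by (auto simp: \<phi>_def)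
  have inj: "inj_on \<phi> V1"
    using H(9) by (auto simp: bij_betw_def inj_on_def \<phi>)
  have sub: "e \<subseteq> V1" if "e \<in> E1" for e using that H(3) by (auto simp: pairs_def)
  have im: "(`) \<phi> ` E1 \<subseteq> E2"
  proof safe
    fix e assume e: "e \<in> E1"
    then obtain u v where uv: "e = {u, v}" "u \<in> V1" "v \<in> V1"
      using H(3) by (auto elim!: pairsE)
    then show "\<phi> ` e \<in> E2" using H(10) e by (simp add: \<phi>)
  qed
  show ?thesis
  proof (rule that[of \<phi> E1])
    show "\<phi> \<in> V \<rightarrow>\<^sub>E V"
      using H(1,4) bij_betwE[OF H(9)] by (auto simp: \<phi>_def) blast
    show "E1 \<subseteq> pairs V" using H(1,3) by (auto simp: pairs_def)
    show "inj_on ((`) \<phi>) E1"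
      using sub by (intro inj_on_subset[OF inj_on_image_Pow[OF inj]]) auto
  qed (use H im in auto)
qed

text \<open>The certificate behind every lower bound: the subgraph \<open>F\<close> on the vertices
  \<open>U\<close> and its image. Taking images is injective on \<open>Pow U\<close>, so a pair lies
  in \<open>F\<close> exactly when its image lies in the image of \<open>F\<close>.\<close>

lemma ISO_ge_card:
  assumes "finite E" "U \<subseteq> V" "inj_on \<phi> U" "\<phi> ` U \<subseteq> V" "F \<subseteq> E" "F \<subseteq> pairs U"
    "(`) \<phi> ` F \<subseteq> E" "F \<inter> (`) \<phi> ` F = {}"
  shows "card F \<le> ISO (V, E)"
proof -
  have inj: "inj_on ((`) \<phi>) (Pow U)" by (rule inj_on_image_Pow[OF assms(3)])
  have FU: "F \<subseteq> Pow U" using assms(6) by (auto simp: pairs_def)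
  have "\<phi> ` e \<in> pairs (\<phi> ` U)" if "e \<in> F" for e
  proof -
    obtain u v where "e = {u, v}" "u \<in> U" "v \<in> U" "u \<noteq> v"
      using assms(6) \<open>e \<in> F\<close> by (meson pairsE subsetD)
    then show ?thesis using assms(3) by (simp add: inj_on_eq_iff)
  qed
  then have "subgraph (U, F) (V, E)" "subgraph (\<phi> ` U, (`) \<phi> ` F) (V, E)"
    using assms by (auto simp: subgraph_def)
  moreover have "isomorphic (U, F) (\<phi> ` U, (`) \<phi> ` F)"
    unfolding isomorphic_def
  proof (intro exI[of _ \<phi>] conjI ballI)
    show "bij_betw \<phi> (fst (U, F)) (fst (\<phi> ` U, (`) \<phi> ` F))" using assms(3) by (simp add: bij_betw_def)
    fix u v assume "u \<in> fst (U, F)" "v \<in> fst (U, F)"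
    then have "{u, v} \<in> F \<longleftrightarrow> \<phi> ` {u, v} \<in> (`) \<phi> ` F"
      using inj_on_image_mem_iff[OF inj, of "{u, v}" F] FU by simp
    then show "{u, v} \<in> snd (U, F) \<longleftrightarrow> {\<phi> u, \<phi> v} \<in> snd (\<phi> ` U, (`) \<phi> ` F)" by simp
  qed
  moreover have "card ((`) \<phi> ` F) = card F"
    by (rule card_image[OF inj_on_subset[OF inj FU]])
  ultimately have "has_iso_pair (V, E) (card F)"
    unfolding has_iso_pair_def using assms(8)
    by (intro exI[of _ "(U, F)"] exI[of _ "(\<phi> ` U, (`) \<phi> ` F)"]) simp
  then show ?thesis by (intro ISO_greatest) (simp_all add: assms(1))
qed

section \<open>Upper tail of \<open>ISO\<close> by a union bound\<close>

text \<open>s^s / s! is a single term of the exponential series at s, whose terms are all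
  nonnegative.\<close>

lemma power_le_exp_mult_fact: "real s ^ s \<le> exp (real s) * fact s"
proof -
  have sm: "(\<lambda>k. real s ^ k / fact k) sums exp (real s)"
    using exp_converges[of "real s"] by (simp add: divide_inverse mult.commute)
  have "(\<Sum>k\<in>{s}. real s ^ k / fact k) \<le> (\<Sum>k. real s ^ k / fact k)"
    by (rule sum_le_suminf) (use sm in \<open>auto simp: sums_iff\<close>)
  then have "real s ^ s / fact s \<le> exp (real s)" using sm by (simp add: sums_iff)
  then show ?thesis by (simp add: field_simps)
qed

lemma binomial_le_exp_power:
  assumes "0 < s"
  shows "real (N choose s) \<le> (exp 1 * real N / real s) ^ s"
proof -
  have "real (N choose s) * real s ^ s \<le> real (N choose s) * (exp (real s) * fact s)"
    by (intro mult_left_mono power_le_exp_mult_fact) auto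
  also have "\<dots> = exp (real s) * real ((N choose s) * fact s)" by simp
  also have "\<dots> \<le> exp (real s) * real (N ^ s)"
    by (intro mult_left_mono) (use binomial_fact_pow[of N s] of_nat_le_iff in \<open>blast, simp\<close>)
  also have "\<dots> = (exp 1 * real N) ^ s" by (simp add: power_mult_distrib exp_of_nat_mult[symmetric])
  finally show ?thesis using assms by (simp add: power_divide field_simps)
qed

text \<open>A union bound over the \<open>n ^ n\<close> maps \<open>\<phi>\<close> and the edge sets \<open>S\<close> of size \<open>\<lceil>t\<rceil>\<close>: disjointness of \<open>S\<close>
  and its image makes the probability that both consist of edges equal to \<open>p ^ (2 * card S)\<close>.\<close>

lemma bit_prob_ISO_ge:
  fixes t a p :: real
  assumes p: "0 \<le> p" "p \<le> 1" and "0 < t" "0 \<le> a" "0 < n"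
    and le: "exp 1 * (real n)\<^sup>2 * p\<^sup>2 \<le> 2 * t * exp (- a)"
  shows "bit_prob (pairs {1..n}) p (\<lambda>b. t \<le> real (ISO (graph_of_bits n b))) \<le> exp (real n * ln n - a * t)"
proof -
  define I where "I = pairs {1..n}"
  have I[simp]: "finite I" by (simp add: I_def)
  define s where "s = nat \<lceil>t\<rceil>"
  have s: "t \<le> real s" "0 < s" using \<open>0 < t\<close> by (auto simp: s_def)
  define T where "T = ({1..n} \<rightarrow>\<^sub>E {1..n}) \<times> {S. S \<subseteq> I \<and> card S = s}"
  have T: "finite T" "real (card T) = real n ^ n * real (card I choose s)"
    by (auto simp: T_def card_cartesian_product card_PiE n_subsets intro!: finite_PiE)
  \<comment> \<open>The first three conjuncts ignore the bits: an unsuitable candidate makes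
    \<open>Q\<close> identically false, and a suitable one demands 2 s distinct edges.\<close>
  define Q where "Q = (\<lambda>(\<phi>, S) b. S \<inter> (`) \<phi> ` S = {} \<and> inj_on ((`) \<phi>) S \<and> (`) \<phi> ` S \<subseteq> I \<and>
      (\<forall>e \<in> S \<union> (`) \<phi> ` S. b e))"
  have Q: "bit_prob I p (Q x) \<le> p ^ (2 * s)" if "x \<in> T" for x
  proof -
    obtain \<phi> S where x: "x = (\<phi>, S)" by (cases x)
    then have S: "S \<subseteq> I" "card S = s" using that by (auto simp: T_def)
    show ?thesis
    proof (cases "S \<inter> (`) \<phi> ` S = {} \<and> inj_on ((`) \<phi>) S \<and> (`) \<phi> ` S \<subseteq> I")
      case True
      have fin: "finite S" using S(1) by (rule finite_subset) simp
      have "card (S \<union> (`) \<phi> ` S) = 2 * s"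
        using True S fin by (subst card_Un_disjoint) (auto simp: card_image)
      moreover have "bit_prob I p (Q x) \<le> bit_prob I p (\<lambda>b. \<forall>e \<in> S \<union> (`) \<phi> ` S. b e)"
        by (rule bit_prob_mono) (simp add: Q_def x)
      moreover have "bit_prob I p (\<lambda>b. \<forall>e \<in> S \<union> (`) \<phi> ` S. b e) = p ^ card (S \<union> (`) \<phi> ` S)"
        by (intro bit_prob_all_ones) (use True S p in auto)
      ultimately show ?thesis by simp
    next
      case False
      then have "Q x = (\<lambda>_. False)" by (auto simp: Q_def x fun_eq_iff)
      then show ?thesis using p by simp
    qed
  qed
  have "bit_prob I p (\<lambda>b. t \<le> real (ISO (graph_of_bits n b))) \<le> bit_prob I p (\<lambda>b. \<exists>x\<in>T. Q x b)"
  proof (rule bit_prob_mono)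
    fix b assume "t \<le> real (ISO (graph_of_bits n b))"
    then have sI: "s \<le> ISO (graph_of_bits n b)" unfolding s_def by linarith
    have "has_iso_pair ({1..n}, {e \<in> I. b e}) (ISO (graph_of_bits n b))"
      using has_iso_pair_ISO[of "graph_of_bits n b"] by (simp add: graph_of_bits_def I_def)
    then obtain \<phi> S where S: "\<phi> \<in> {1..n} \<rightarrow>\<^sub>E {1..n}" "S \<subseteq> I" "S \<subseteq> {e \<in> I. b e}"
      "(`) \<phi> ` S \<subseteq> {e \<in> I. b e}" "S \<inter> (`) \<phi> ` S = {}"
      "card S = ISO (graph_of_bits n b)" "inj_on ((`) \<phi>) S"
      unfolding I_def by (rule has_iso_pair_imp_map)
    \<comment> \<open>\<open>ISO\<close> may exceed \<open>s\<close>; a subset of exactly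
      \<open>s\<close> edges inherits all conditions and fixes the size of the candidates.\<close>
    obtain S' where S': "S' \<subseteq> S" "card S' = s"
      using obtain_subset_with_card_n[of s S] sI S(6) by metis
    have "(\<phi>, S') \<in> T" using S S' by (auto simp: T_def)
    moreover have "Q (\<phi>, S') b"
      using S S'(1) inj_on_subset[OF S(7) S'(1)] unfolding Q_def by blast
    ultimately show "\<exists>x\<in>T. Q x b" ..
  qed
  also have "\<dots> \<le> real n ^ n * real (card I choose s) * p ^ (2 * s)"
    unfolding T(2)[symmetric] by (rule bit_prob_union_bound[OF T(1) Q])
  also have "\<dots> \<le> real n ^ n * (exp 1 * real (card I) / real s) ^ s * p ^ (2 * s)"
    using p s by (intro mult_right_mono mult_left_mono binomial_le_exp_power) auto
  also have "\<dots> = real n ^ n * (exp 1 * real (card I) * p\<^sup>2 / real s) ^ s"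
    by (simp add: power_mult power_mult_distrib power_divide)
  also have "\<dots> \<le> real n ^ n * exp (- a) ^ s"
  proof (intro mult_left_mono power_mono)
    \<comment> \<open>With at most n^2 / 2 pairs and s >= t, the hypothesis bounds the base of the
      power by exp (- a).\<close>
    have "2 * real (card I) \<le> (real n)\<^sup>2"
    proof -
      have "2 * card I \<le> n * n"
        by (simp add: I_def card_pairs choose_two) (meson diff_le_self le_trans mult_le_mono2 times_div_less_eq_dividend)
      then show ?thesis unfolding power2_eq_square
        by (metis of_nat_le_iff of_nat_mult of_nat_numeral)
    qed
    then have "exp 1 * (2 * real (card I)) * p\<^sup>2 \<le> exp 1 * (real n)\<^sup>2 * p\<^sup>2"
      by (intro mult_right_mono mult_left_mono) auto
    also note le
    also have "2 * t * exp (- a) \<le> 2 * real s * exp (- a)" using s by simp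
    finally show "exp 1 * real (card I) * p\<^sup>2 / real s \<le> exp (- a)"
      using s by (simp add: field_simps)
  qed (use p in auto)
  also have "\<dots> = exp (real n * ln n) * exp (- a * s)"
    using \<open>0 < n\<close> by (simp only: exp_of_nat_mult exp_of_nat2_mult exp_ln of_nat_0_less_iff)
  also have "\<dots> \<le> exp (real n * ln n) * exp (- a * t)"
    using s \<open>0 \<le> a\<close> by (simp add: mult_left_mono)
  also have "\<dots> = exp (real n * ln n - a * t)" by (simp add: exp_add[symmetric])
  finally show ?thesis unfolding I_def .
qed

section \<open>Lower bound of order n^2 p^2 by translation\<close>

text \<open>Pairs inside the first half never coincide with translated ones, and the translation is
  injective. Hence the sets {e, \<phi> e} are disjoint two-element sets of coordinates, and the
  events that both members are edges are independent with probability p^2 each.\<close>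

lemma bit_prob_ISO_shift:
  fixes p :: real and n :: nat
  assumes p: "0 \<le> p" "p \<le> 1"
  defines "N \<equiv> real ((n div 2) choose 2)"
  shows "bit_prob (pairs {1..n}) p (\<lambda>b. real (ISO (graph_of_bits n b)) \<le> p\<^sup>2 * N / 4) \<le> exp (- p\<^sup>2 * N / 4)"
proof -
  define m where "m = n div 2"
  define I where "I = pairs {1..n}"
  have I[simp]: "finite I" by (simp add: I_def)
  define J where "J = pairs {1..m}"
  have J: "finite J" "N = real (card J)" by (simp_all add: J_def N_def m_def card_pairs)
  define \<phi> where "\<phi> = (\<lambda>v::nat. v + m)"
  define Q where "Q = (\<lambda>e b. b e \<and> b (\<phi> ` e))"
  have inj: "inj_on \<phi> X" for X by (auto simp: \<phi>_def)
  have \<phi>: "\<phi> ` e \<in> I" "e \<in> I" "e \<subseteq> {1..m}" "\<phi> ` e \<inter> {1..m} = {}" "e \<noteq> {}" if "e \<in> J" for e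
  proof -
    obtain u v where uv: "e = {u, v}" "u \<in> {1..m}" "v \<in> {1..m}" "u \<noteq> v"
      using \<open>e \<in> J\<close> unfolding J_def by (rule pairsE)
    then have "u + m \<le> n" "v + m \<le> n" by (auto simp: m_def)
    then show "\<phi> ` e \<in> I" "e \<in> I" "e \<subseteq> {1..m}" "\<phi> ` e \<inter> {1..m} = {}" "e \<noteq> {}"
      using uv by (auto simp: I_def \<phi>_def)
  qed
  have ne: "e \<noteq> \<phi> ` e'" if "e \<in> J" "e' \<in> J" for e e' 
    using \<phi>(3,5)[OF that(1)] \<phi>(4)[OF that(2)] by (metis inf.absorb1)
  have "bit_prob I p (\<lambda>b. real (card {e \<in> J. Q e b}) \<le> p\<^sup>2 * card J / 4) \<le> exp (- p\<^sup>2 * card J / 4)"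
  proof (rule bit_prob_Chernoff[where S = "\<lambda>e. {e, \<phi> ` e}", OF I J(1)])
    fix e assume e: "e \<in> J"
    show "depends_on (Q e) {e, \<phi> ` e}" by (auto simp: depends_on_def Q_def)
    have "bit_prob I p (\<lambda>b. \<forall>i\<in>{e, \<phi> ` e}. b i) = p ^ card {e, \<phi> ` e}"
      by (rule bit_prob_all_ones) (use \<phi> e p in auto)
    also have "card {e, \<phi> ` e} = 2" using ne[OF e e] by simp
    finally show "p\<^sup>2 \<le> bit_prob I p (Q e)" by (simp add: Q_def)
  next
    show "disjoint_family_on (\<lambda>e. {e, \<phi> ` e}) J"
      using ne inj_image_eq_iff[OF inj] unfolding disjoint_family_on_def by blast
  qed
  moreover have "bit_prob I p (\<lambda>b. real (ISO (graph_of_bits n b)) \<le> p\<^sup>2 * N / 4) \<le>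
      bit_prob I p (\<lambda>b. real (card {e \<in> J. Q e b}) \<le> p\<^sup>2 * card J / 4)"
  proof (rule bit_prob_mono)
    fix b assume *: "real (ISO (graph_of_bits n b)) \<le> p\<^sup>2 * N / 4"
    have "card {e \<in> J. Q e b} \<le> ISO (graph_of_bits n b)"
      unfolding graph_of_bits_def
    proof (rule ISO_ge_card[where U = "{1..m}" and \<phi> = \<phi>])
      show "{e \<in> J. Q e b} \<inter> (`) \<phi> ` {e \<in> J. Q e b} = {}" using ne by blast
      show "{e \<in> J. Q e b} \<subseteq> {e \<in> pairs {1..n}. b e}" "(`) \<phi> ` {e \<in> J. Q e b} \<subseteq> {e \<in> pairs {1..n}. b e}"
        using \<phi> by (auto simp: Q_def I_def)
    qed (auto simp: inj J_def \<phi>_def m_def)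
    then show "real (card {e \<in> J. Q e b}) \<le> p\<^sup>2 * card J / 4"
      using * unfolding J(2) by linarith
  qed
  ultimately show ?thesis unfolding I_def J(2) by linarith
qed

section \<open>Linear lower bound from matchings\<close>

text \<open>The 2 k endpoints are listed in one sequence with consecutive entries paired, so that an
  index shift by an even number carries edges of the matching to edges of the matching.\<close>

definition has_matching :: "'a graph \<Rightarrow> nat \<Rightarrow> bool" where
  "has_matching G k \<longleftrightarrow> (\<exists>w :: nat \<Rightarrow> 'a. inj_on w {..<2 * k} \<and> w ` {..<2 * k} \<subseteq> fst G \<and>
     (\<forall>i<k. {w (2 * i), w (2 * i + 1)} \<in> snd G))"

text \<open>Shifting the index by 2 h maps the first h edges of the matching onto the last h;
  injectivity of the listing makes the two halves disjoint.\<close>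

lemma ISO_ge_matching:
  assumes "finite E" "has_matching (V, E) (2 * h)"
  shows "h \<le> ISO (V, E)"
proof -
  obtain w where w: "inj_on w {..<4 * h}" "w ` {..<4 * h} \<subseteq> V"
    "\<And>i. i < 2 * h \<Longrightarrow> {w (2 * i), w (2 * i + 1)} \<in> E"
    using assms(2) unfolding has_matching_def by auto
  define U where "U = w ` {..<2 * h}"
  define \<phi> where "\<phi> = (\<lambda>v. w (inv_into {..<4 * h} w v + 2 * h))"
  have \<phi>: "\<phi> (w i) = w (i + 2 * h)" if "i < 2 * h" for i
    using inv_into_f_f[OF w(1), of i] that by (simp add: \<phi>_def)
  have eq: "w i = w j \<longleftrightarrow> i = j" if "i < 4 * h" "j < 4 * h" for i j
    using inj_on_eq_iff[OF w(1)] that by simp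
  define F where "F = (\<lambda>i. {w (2 * i), w (2 * i + 1)}) ` {..<h}"
  have \<phi>F: "(`) \<phi> ` F = (\<lambda>i. {w (2 * i + 2 * h), w (2 * i + 1 + 2 * h)}) ` {..<h}"
    unfolding F_def image_image by (intro image_cong) (auto simp: \<phi>)
  have "inj_on (\<lambda>i. {w (2 * i), w (2 * i + 1)}) {..<h}"
    by (rule inj_onI) (auto simp: doubleton_eq_iff eq)
  then have "h = card F" by (simp add: F_def card_image)
  also have "\<dots> \<le> ISO (V, E)"
  proof (rule ISO_ge_card[OF assms(1), where U = U and \<phi> = \<phi>])
    show "inj_on \<phi> U" by (auto simp: inj_on_def U_def \<phi> eq)
    show "F \<subseteq> pairs U" by (auto simp: F_def U_def eq)
    show "(`) \<phi> ` F \<subseteq> E" unfolding \<phi>F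
    proof safe
      fix i assume "i < h"
      then show "{w (2 * i + 2 * h), w (2 * i + 1 + 2 * h)} \<in> E"
        using w(3)[of "i + h"] by (simp add: algebra_simps)
    qed
    show "F \<inter> (`) \<phi> ` F = {}"
      unfolding \<phi>F by (auto simp: F_def doubleton_eq_iff eq)
  qed (use w in \<open>auto simp: F_def U_def \<phi>\<close>)
  finally show ?thesis .
qed

text \<open>The vertices missed by a maximum matching span no edge, since such an edge would enlarge
  it. With fewer than k matching edges, at least l vertices are missed.\<close>

lemma no_matching_imp_independent:
  assumes "finite V" "\<not> has_matching (V, E) k" "l + 2 * k \<le> card V"
  obtains W where "W \<subseteq> V" "card W = l" "pairs W \<inter> E = {}"
proof -
  have "has_matching (V, E) 0" by (simp add: has_matching_def)
  \<comment> \<open>A matching of size 0 exists and one of size k does not, so there is a j at which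
    existence breaks off.\<close>
  then obtain j where j: "j < k" "has_matching (V, E) j" "\<not> has_matching (V, E) (Suc j)"
    using assms(2) by (metis gr0I less_Suc_eq nat_less_le inc_induct[of 0 k] dec_induct[of 0 k] zero_le)
  obtain w where w: "inj_on w {..<2 * j}" "w ` {..<2 * j} \<subseteq> V"
    "\<And>i. i < j \<Longrightarrow> {w (2 * i), w (2 * i + 1)} \<in> E"
    using j(2) unfolding has_matching_def by auto
  define W0 where "W0 = V - w ` {..<2 * j}"
  have "card W0 = card V - 2 * j"
    unfolding W0_def using w assms(1) by (subst card_Diff_subset) (auto simp: card_image)
  then have "l \<le> card W0" using assms(3) j(1) by simp
  then obtain W where W: "W \<subseteq> W0" "card W = l" by (meson obtain_subset_with_card_n)
  have "pairs W0 \<inter> E = {}"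
  proof (rule ccontr)
    assume "pairs W0 \<inter> E \<noteq> {}"
    then obtain x y where xy: "{x, y} \<in> E" "x \<in> W0" "y \<in> W0" "x \<noteq> y" by (auto elim!: pairsE)
    define w' where "w' = w(2 * j := x, 2 * j + 1 := y)"
    have w'_old: "w' i = w i" if "i < 2 * j" for i using that by (auto simp: w'_def)
    have set: "{..<2 * Suc j} = insert (2 * j) (insert (2 * j + 1) {..<2 * j})" by auto
    have im: "w' ` {..<2 * j} = w ` {..<2 * j}" by (intro image_cong) (auto simp: w'_old)
    have "inj_on w' {..<2 * j}" using w(1) by (simp add: inj_on_def w'_old)
    then have "inj_on w' {..<2 * Suc j}"
      unfolding set using xy im by (auto simp: w'_def W0_def)
    moreover have "w' ` {..<2 * Suc j} \<subseteq> V"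
      unfolding set image_insert im using w(2) xy by (auto simp: w'_def W0_def)
    moreover have "{w' (2 * i), w' (2 * i + 1)} \<in> E" if "i < Suc j" for i
      using w(3)[of i] that xy(1) by (cases "i = j") (auto simp: w'_def)
    ultimately have "has_matching (V, E) (Suc j)" unfolding has_matching_def by auto
    then show False using j(3) by simp
  qed
  then have "pairs W \<inter> E = {}" using W(1) by (auto simp: pairs_def)
  with W show ?thesis by (intro that[of W]) (auto simp: W0_def)
qed

text \<open>If there is no matching of size 2 h, then some n - 4 h vertices are independent; the
  bound is a union bound over the choices of this vertex set.\<close>

lemma bit_prob_ISO_matching:
  assumes p: "0 \<le> p" "p \<le> 1" and "4 * h \<le> n"
  shows "bit_prob (pairs {1..n}) p (\<lambda>b. ISO (graph_of_bits n b) < h)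
    \<le> real (n choose (4 * h)) * (1 - p) ^ ((n - 4 * h) choose 2)"
proof -
  define T where "T = {W. W \<subseteq> {1..n} \<and> card W = n - 4 * h}"
  have T: "finite T" "card T = n choose (4 * h)"
    using n_subsets[of "{1..n}" "n - 4 * h"] binomial_symmetric[OF assms(3)] by (auto simp: T_def)
  have "bit_prob (pairs {1..n}) p (\<lambda>b. ISO (graph_of_bits n b) < h)
      \<le> bit_prob (pairs {1..n}) p (\<lambda>b. \<exists>W\<in>T. \<forall>e\<in>pairs W. \<not> b e)"
  proof (rule bit_prob_mono)
    fix b assume "ISO (graph_of_bits n b) < h"
    then have "\<not> has_matching (graph_of_bits n b) (2 * h)"
      using ISO_ge_matching[of "snd (graph_of_bits n b)" "fst (graph_of_bits n b)" h] by auto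
    then obtain W where W: "W \<subseteq> {1..n}" "card W = n - 4 * h" "pairs W \<inter> {e \<in> pairs {1..n}. b e} = {}"
      unfolding graph_of_bits_def
      by (rule no_matching_imp_independent[rotated, where l = "n - 4 * h"]) (use assms(3) in auto)
    then have "\<forall>e\<in>pairs W. \<not> b e" unfolding pairs_def by blast
    with W show "\<exists>W\<in>T. \<forall>e\<in>pairs W. \<not> b e" by (auto simp: T_def)
  qed
  also have "\<dots> \<le> real (card T) * (1 - p) ^ ((n - 4 * h) choose 2)"
  proof (rule bit_prob_union_bound[OF T(1)])
    fix W assume W: "W \<in> T"
    then have "finite W" by (auto simp: T_def intro: finite_subset)
    have "bit_prob (pairs {1..n}) p (\<lambda>b. \<forall>e\<in>pairs W. \<not> b e) = (1 - p) ^ card (pairs W)"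
      by (rule bit_prob_all_zeros) (use W p in \<open>auto simp: T_def pairs_def\<close>)
    then show "bit_prob (pairs {1..n}) p (\<lambda>b. \<forall>e\<in>pairs W. \<not> b e) \<le> (1 - p) ^ ((n - 4 * h) choose 2)"
      using W \<open>finite W\<close> by (simp add: card_pairs T_def)
  qed
  finally show ?thesis using T(2) by simp
qed

lemma real_choose_two: "real (k choose 2) = real k * (real k - 1) / 2"
  by (cases k) (auto simp: choose_two real_of_nat_div field_simps)

lemma one_minus_power_le_exp: "0 \<le> p \<Longrightarrow> p \<le> 1 \<Longrightarrow> (1 - p) ^ k \<le> exp (- p * real k)" for p :: real
proof -
  assume "0 \<le> p" "p \<le> 1"
  then have "(1 - p) ^ k \<le> exp (- p) ^ k"
    using exp_ge_add_one_self[of "- p"] by (intro power_mono) auto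
  then show ?thesis using exp_of_nat_mult[of k "- p"] by (simp add: mult.commute)
qed

lemma eventually_ISO_linear:
  "\<forall>\<^sub>F n in sequentially. \<forall>p. 1 / (2 * real n) \<le> p \<and> p \<le> 1 \<longrightarrow>
     bit_prob (pairs {1..n}) p (\<lambda>b. real (ISO (graph_of_bits n b)) < real n / 400) \<le> 1 / real n"
proof -
  have "\<forall>\<^sub>F n in sequentially. ln (real n) \<le> 12 / 100 * real n - 25 / 100" by real_asymp
  then show ?thesis
    using eventually_ge_at_top[of 10000]
  proof eventually_elim
    case (elim n)
    \<comment> \<open>A matching of size 2 h covers K = 4 h vertices, about n / 50. There are at
      most exp (0.12 n) sets of n - K vertices, while p >= 1 / (2 n) makes each of them independent
      with probability at most about exp (- 0.24 n).\<close>
    define h where "h = n div 200"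
    define K where "K = 4 * h"
    have hr: "real n / 200 - 1 \<le> real h" "real h \<le> real n / 200" unfolding h_def by linarith+
    then have Kr: "real n / 50 - 4 \<le> real K" "real K \<le> real n / 50" by (auto simp: K_def)
    then have K: "0 < K" "K \<le> n" using elim by linarith+
    show ?case
    proof (intro allI impI, elim conjE)
      fix p :: real assume p: "1 / (2 * real n) \<le> p" "p \<le> 1"
      have p0: "0 \<le> p" by (rule order_trans[OF _ p(1)]) simp
      have "bit_prob (pairs {1..n}) p (\<lambda>b. real (ISO (graph_of_bits n b)) < real n / 400)
          \<le> bit_prob (pairs {1..n}) p (\<lambda>b. ISO (graph_of_bits n b) < h)"
        by (rule bit_prob_mono) (use hr elim in linarith)
      also have "\<dots> \<le> real (n choose K) * (1 - p) ^ ((n - K) choose 2)"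
        unfolding K_def using K p p0 by (intro bit_prob_ISO_matching) (auto simp: K_def)
      also have "\<dots> \<le> exp (12 / 100 * real n) * exp (- (24 / 100 * real n - 25 / 100))"
      proof (intro mult_mono)
        have "real (n choose K) \<le> (exp 1 * real n / real K) ^ K" by (rule binomial_le_exp_power[OF K(1)])
        \<comment> \<open>The base is bounded through e n <= 2.72 n <= 150 K and 150 <= (5/2)^6 <=
          e^6; the exponent 6 K is at most 0.12 n.\<close>
        also have "\<dots> \<le> exp 6 ^ K"
        proof (rule power_mono)
          have "exp 1 * real n \<le> 272 / 100 * real n"
            using e_less_272 by (intro mult_right_mono) auto
          also have "\<dots> \<le> 150 * real K" using Kr elim by linarith
          also have "\<dots> \<le> exp 6 * real K"
          proof (rule mult_right_mono)
            have "(5 / 2) ^ 6 \<le> exp (1::real) ^ 6"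
              using exp_lower_Taylor_quadratic[of 1] by (intro power_mono) auto
            also have "\<dots> = exp 6" by (simp add: exp_of_nat_mult[symmetric])
            finally show "150 \<le> exp (6::real)" by (simp add: power_divide)
          qed simp
          finally show "exp 1 * real n / real K \<le> exp 6" using K by (simp add: field_simps)
        qed (use K in auto)
        also have "\<dots> = exp (real K * 6)" by (simp only: exp_of_nat_mult)
        also have "\<dots> \<le> exp (12 / 100 * real n)" using Kr by simp
        finally show "real (n choose K) \<le> exp (12 / 100 * real n)" .
        have "(1 - p) ^ ((n - K) choose 2) \<le> exp (- p * real ((n - K) choose 2))"
          by (rule one_minus_power_le_exp) (use p p0 in auto)
        also have "\<dots> \<le> exp (- (24 / 100 * real n - 25 / 100))"
        proof -
          define x where "x = real (n - K)"
          have x: "98 / 100 * real n \<le> x" using Kr K by (simp add: x_def of_nat_diff)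
          have "24 / 100 * real n - 25 / 100 \<le> 1 / (2 * real n) * ((98 / 100 * real n) * (98 / 100 * real n - 1) / 2)"
            using elim by (simp add: field_simps power2_eq_square)
          also have "\<dots> \<le> p * (x * (x - 1) / 2)"
            using x p p0 elim by (intro mult_mono divide_right_mono) auto
          finally show ?thesis unfolding real_choose_two x_def by simp
        qed
        finally show "(1 - p) ^ ((n - K) choose 2) \<le> exp (- (24 / 100 * real n - 25 / 100))" .
      qed (use p in auto)
      also have "\<dots> = exp (- (12 / 100 * real n - 25 / 100))" by (simp add: exp_add[symmetric])
      also have "\<dots> \<le> exp (- ln (real n))" using elim by simp
      also have "\<dots> = 1 / real n" using elim by (simp add: exp_minus field_simps)
      finally show "bit_prob (pairs {1..n}) p (\<lambda>b. real (ISO (graph_of_bits n b)) < real n / 400) \<le> 1 / real n" .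
    qed
  qed
qed

section \<open>Lower bound from isomorphic stars at matched vertices\<close>

lemma bit_prob_ones_zeros:
  assumes "finite I" "T1 \<subseteq> I" "T0 \<subseteq> I" "T1 \<inter> T0 = {}" "0 \<le> p" "p \<le> 1"
  shows "bit_prob I p (\<lambda>b. (\<forall>i\<in>T1. b i) \<and> (\<forall>i\<in>T0. \<not> b i)) = p ^ card T1 * (1 - p) ^ card T0"
proof -
  have dep: "depends_on (\<lambda>b. \<forall>i\<in>T. b i) T" "depends_on (\<lambda>b. \<forall>i\<in>T. \<not> b i) T" for T :: "'a set"
    by (auto simp: depends_on_def)
  have "bit_prob I p (\<lambda>b. (\<forall>i\<in>T1. b i) \<and> (\<forall>i\<in>T0. \<not> b i)) =
      measure_pmf.expectation (bits I p) (\<lambda>b. of_bool (\<forall>i\<in>T1. b i) * of_bool (\<forall>i\<in>T0. \<not> b i))"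
    unfolding bit_prob_expectation by (rule Bochner_Integration.integral_cong) auto
  also have "\<dots> = bit_prob I p (\<lambda>b. \<forall>i\<in>T1. b i) * bit_prob I p (\<lambda>b. \<forall>i\<in>T0. \<not> b i)"
    unfolding bit_prob_expectation
    by (rule expectation_mult_bits[OF assms(1) depends_on_comp[OF dep(1)] depends_on_comp[OF dep(2)] assms(4)])
  finally show ?thesis
    using assms by (simp add: bit_prob_all_ones bit_prob_all_zeros)
qed

lemma bits_restrict:
  assumes "finite I" "T \<subseteq> I"
  shows "bits T p = map_pmf (\<lambda>b i. if i \<in> T then b i else False) (bits I p)"
  unfolding bits_def by (rule Pi_pmf_subset[OF assms])

text \<open>Keeps only d of the coordinates and only the event of exactly k ones among them; the
  binomial coefficient is at least (d / k)^k.\<close>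

lemma bit_prob_card_ge:
  fixes p :: real
  assumes "finite I" "T \<subseteq> I" "0 \<le> p" "p \<le> 1" "d \<le> card T" "k \<le> d"
  shows "(real d / real k) ^ k * p ^ k * (1 - p) ^ d \<le> bit_prob I p (\<lambda>b. k \<le> card {i\<in>T. b i})"
proof -
  obtain T' where T': "T' \<subseteq> T" "card T' = d" using assms(5) by (meson obtain_subset_with_card_n)
  have fin: "finite T" using assms(2,1) by (rule finite_subset)
  have fin': "finite T'" using T'(1) fin by (rule finite_subset)
  have "(real d / real k) ^ k * p ^ k * (1 - p) ^ d \<le> real (d choose k) * p ^ k * (1 - p) ^ (d - k)"
  proof (rule mult_mono)
    have "(real d / real k) ^ k \<le> real (d choose k)"
      using binomial_ge_n_over_k_pow_k[OF assms(6), where 'a = real] by simp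
    then show "(real d / real k) ^ k * p ^ k \<le> real (d choose k) * p ^ k"
      using assms(3) by (simp add: mult_right_mono)
    show "(1 - p) ^ d \<le> (1 - p) ^ (d - k)"
      using assms(3,4) by (intro power_decreasing) auto
  qed (use assms(3,4) in simp_all)
  also have "\<dots> = pmf (binomial_pmf d p) k" using assms by simp
  also have "\<dots> = measure_pmf.prob (bits T' p) {b. card {i\<in>T'. b i} = k}"
    using fin' T' assms by (subst binomial_pmf_altdef'[where A = T' and dflt = False])
      (auto simp: bits_def pmf_map vimage_def)
  also have "\<dots> \<le> bit_prob I p (\<lambda>b. k \<le> card {i\<in>T. b i})"
    unfolding bits_restrict[OF assms(1) subset_trans[OF T'(1) assms(2)]] measure_map_pmf
  proof (rule measure_pmf.finite_measure_mono)
    have "card {i \<in> T'. b i} \<le> card {i \<in> T. b i}" for b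
      using T'(1) fin by (intro card_mono) auto
    then show "(\<lambda>b i. if i \<in> T' then b i else False) -` {b. card {i \<in> T'. b i} = k} \<subseteq> {b. k \<le> card {i \<in> T. b i}}"
      by (auto cong: conj_cong)
  qed simp
  finally show ?thesis .
qed

text \<open>Greedy extension: as long as fewer than m / 2 vertices are matched, more than m / 2
  remain on each side, and \<open>dense\<close> supplies another edge between the
  remainders.\<close>

lemma bipartite_large_matching:
  assumes fin: "finite X" "finite Y" and card: "card X = m" "card Y = m"
    and dense: "\<And>X' Y'. X' \<subseteq> X \<Longrightarrow> Y' \<subseteq> Y \<Longrightarrow> m < 2 * card X' \<Longrightarrow> m < 2 * card Y' \<Longrightarrow> \<exists>x\<in>X'. \<exists>y\<in>Y'. G x y"
  obtains X0 g where "X0 \<subseteq> X" "inj_on g X0" "g ` X0 \<subseteq> Y" "\<And>x. x \<in> X0 \<Longrightarrow> G x (g x)" "m \<le> 2 * card X0"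
proof -
  have "\<exists>X0 g. X0 \<subseteq> X \<and> inj_on g X0 \<and> g ` X0 \<subseteq> Y \<and> (\<forall>x\<in>X0. G x (g x)) \<and> card X0 = j"
    \<comment> \<open>The bound admits j = (m + 1) div 2, which covers at least half of
      \<open>X\<close> for either parity of m.\<close>
    if "2 * j < m + 2" for j
    using that
  proof (induction j)
    case 0
    then show ?case by (intro exI[of _ "{}"]) simp
  next
    case (Suc j)
    then obtain X0 g where IH: "X0 \<subseteq> X" "inj_on g X0" "g ` X0 \<subseteq> Y" "\<forall>x\<in>X0. G x (g x)" "card X0 = j"
      by auto
    have "card (X - X0) = m - j" "card (Y - g ` X0) = m - j"
      using IH fin card by (simp_all add: card_Diff_subset finite_subset card_image)
    moreover have "m < 2 * (m - j)"
    proof -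
      have "2 * j < m" using Suc.prems by simp
      then show ?thesis by arith
    qed
    ultimately obtain x y where xy: "x \<in> X - X0" "y \<in> Y - g ` X0" "G x y"
      using dense[of "X - X0" "Y - g ` X0"] Suc.prems by auto
    have "inj_on (g(x := y)) (insert x X0)"
      using IH xy by (auto simp: inj_on_def)
    moreover have "card (insert x X0) = Suc j" using IH xy fin by (simp add: finite_subset)
    moreover have "g(x := y) ` insert x X0 \<subseteq> Y" using IH xy by auto
    moreover have "\<forall>z\<in>insert x X0. G z ((g(x := y)) z)" using IH xy by auto
    moreover have "insert x X0 \<subseteq> X" using IH(1) xy(1) by auto
    ultimately show ?case by (intro exI[of _ "insert x X0"] exI[of _ "g(x := y)"] conjI)
  qed
  from this[of "(m + 1) div 2"] have "\<exists>X0 g. X0 \<subseteq> X \<and> inj_on g X0 \<and> g ` X0 \<subseteq> Y \<and>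
      (\<forall>x\<in>X0. G x (g x)) \<and> card X0 = (m + 1) div 2" by simp
  then obtain X0 g where "X0 \<subseteq> X" "inj_on g X0" "g ` X0 \<subseteq> Y" "\<forall>x\<in>X0. G x (g x)"
    "card X0 = (m + 1) div 2" by blast
  then show ?thesis by (intro that[of X0 g]) auto
qed

text \<open>The vertex sets \<open>X\<close>, \<open>A\<close>, \<open>Y\<close>, \<open>B\<close> are four consecutive intervals of length \<open>m\<close>; the
  translation by \<open>2 * m\<close> maps \<open>A\<close> to \<open>B\<close>, and \<open>X\<close> is cut into \<open>M\<close> blocks of length \<open>L\<close>.
  A vertex of \<open>X\<close> only uses its neighbours in \<open>A\<close> that have no other neighbour in its block;
  given the edges between \<open>X\<close> and \<open>A\<close>, this makes the events \<open>good k b x y\<close> independent over the pairs \<open>(x, y)\<close> with \<open>x\<close> in one block.\<close>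

locale block_layout =
  fixes n L M :: nat and p :: real
  assumes L: "0 < L" and n: "4 * (L * M) \<le> n" and p: "0 \<le> p" "p \<le> 1"
begin

definition "m = L * M"
definition "I = pairs {1..n}"
definition "X = {1..m}"
definition "A = {m + 1..2 * m}"
definition "Y = {2 * m + 1..3 * m}"
definition block :: "nat \<Rightarrow> nat" where "block x = (x - 1) div L"

definition private_nbrs :: "(nat set \<Rightarrow> bool) \<Rightarrow> nat \<Rightarrow> nat set" where
  "private_nbrs b x = {a \<in> A. b {x, a} \<and> (\<forall>x'\<in>X. block x' = block x \<and> x' \<noteq> x \<longrightarrow> \<not> b {x', a})}"

text \<open>The chosen private neighbours a of \<open>x\<close> and their translates span isomorphic
  stars centred at \<open>x\<close> and \<open>y\<close>.\<close>

definition good :: "nat \<Rightarrow> (nat set \<Rightarrow> bool) \<Rightarrow> nat \<Rightarrow> nat \<Rightarrow> bool" where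
  "good k b x y \<longleftrightarrow> k \<le> card {a \<in> private_nbrs b x. b {y, a + 2 * m}}"

definition XA :: "nat set set" where "XA = (\<lambda>(x, a). {x, a}) ` (X \<times> A)"

lemma finite_sets [simp]: "finite I" "finite X" "finite A" "finite Y"
  by (simp_all add: I_def X_def A_def Y_def)

lemma card_sets [simp]: "card X = m" "card A = m" "card Y = m"
  by (simp_all add: X_def A_def Y_def)

lemma m_le: "4 * m \<le> n" using n by (simp add: m_def)

lemma edge_eq_XA: "x \<in> X \<Longrightarrow> x' \<in> X \<Longrightarrow> a \<in> A \<Longrightarrow> a' \<in> A \<Longrightarrow> {x, a} = {x', a'} \<longleftrightarrow> x = x' \<and> a = a'"
  by (auto simp: doubleton_eq_iff X_def A_def)

lemma edge_eq_YB: "y \<in> Y \<Longrightarrow> y' \<in> Y \<Longrightarrow> a \<in> A \<Longrightarrow> a' \<in> A \<Longrightarrow>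
    {y, a + 2 * m} = {y', a' + 2 * m} \<longleftrightarrow> y = y' \<and> a = a'"
  by (auto simp: doubleton_eq_iff Y_def A_def)

lemma edge_in_I: "x \<in> X \<Longrightarrow> a \<in> A \<Longrightarrow> {x, a} \<in> I" "y \<in> Y \<Longrightarrow> a \<in> A \<Longrightarrow> {y, a + 2 * m} \<in> I"
  using m_le by (auto simp: I_def X_def A_def Y_def)

lemma edge_YB_notin_XA: "y \<in> Y \<Longrightarrow> a \<in> A \<Longrightarrow> {y, a + 2 * m} \<notin> XA"
  by (auto simp: XA_def X_def A_def Y_def doubleton_eq_iff)

lemma private_nbrs_subset: "private_nbrs b x \<subseteq> A" by (auto simp: private_nbrs_def)

lemma private_nbrs_disjoint:
  "x \<in> X \<Longrightarrow> x' \<in> X \<Longrightarrow> block x = block x' \<Longrightarrow> x \<noteq> x' \<Longrightarrow> private_nbrs b x \<inter> private_nbrs b x' = {}"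
  by (auto simp: private_nbrs_def)

lemma private_nbrs_cong:
  "x \<in> X \<Longrightarrow> (\<And>e. e \<in> XA \<Longrightarrow> b e = b' e) \<Longrightarrow> private_nbrs b x = private_nbrs b' x"
proof -
  assume "x \<in> X" "\<And>e. e \<in> XA \<Longrightarrow> b e = b' e"
  then have "b {x', a} = b' {x', a}" if "x' \<in> X" "a \<in> A" for x' a
    using that by (auto simp: XA_def)
  with \<open>x \<in> X\<close> show ?thesis unfolding private_nbrs_def by blast
qed

lemma block_less: "x \<in> X \<Longrightarrow> block x < M"
  using L by (auto simp: block_def X_def m_def less_mult_imp_div_less mult.commute div_less_iff_less_mult)

lemma card_block_le: "card {x \<in> X. block x = j} \<le> L"
proof -
  have "{x \<in> X. block x = j} \<subseteq> {j * L + 1..j * L + L}"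
  proof safe
    fix x assume x: "x \<in> X"
    have "block x * L \<le> x - 1" "x - 1 < block x * L + L"
      using L div_times_less_eq_dividend[of "x - 1" L] dividend_less_div_times[of L "x - 1"]
      by (auto simp: block_def)
    then show "x \<in> {block x * L + 1..block x * L + L}" using x by (auto simp: X_def)
  qed
  then have "card {x \<in> X. block x = j} \<le> card {j * L + 1..j * L + L}" by (intro card_mono) auto
  then show ?thesis by simp
qed

text \<open>Pigeonhole: if all M blocks held at most L / 2 elements of \<open>X'\<close>, then
  \<open>X'\<close> would have at most m / 2 elements.\<close>

lemma dense_block:
  assumes "X' \<subseteq> X" "m < 2 * card X'"
  obtains j where "L \<le> 2 * card {x \<in> X'. block x = j}"
proof (rule ccontr)
  assume "\<not> thesis"
  then have small: "2 * card {x \<in> X'. block x = j} \<le> L" for j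
    using that by (meson nat_le_linear)
  have X': "X' = (\<Union>j<M. {x \<in> X'. block x = j})" using assms(1) block_less by auto
  have "card X' \<le> (\<Sum>j<M. card {x \<in> X'. block x = j})"
    by (subst X') (rule card_UN_le, simp)
  then have "2 * card X' \<le> (\<Sum>j<M. 2 * card {x \<in> X'. block x = j})"
    by (simp add: sum_distrib_left[symmetric])
  also have "\<dots> \<le> (\<Sum>j<M. L)" by (intro sum_mono small)
  finally show False using assms(2) by (simp add: m_def mult.commute)
qed

text \<open>The union of the stars at the vertices of \<open>X0\<close> is one of the two subgraphs.
  It lies between \<open>X\<close> and \<open>A\<close> and its image between \<open>Y\<close> and
  \<open>B\<close>, hence they are edge-disjoint; each star contributes at least \<open>k\<close>
  edges.\<close>

lemma ISO_ge_good_matching: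
  assumes X0: "X0 \<subseteq> X" "inj_on g X0" "g ` X0 \<subseteq> Y" "\<And>x. x \<in> X0 \<Longrightarrow> good k b x (g x)"
  shows "k * card X0 \<le> ISO (graph_of_bits n b)"
proof -
  define K where "K x = {a \<in> private_nbrs b x. b {g x, a + 2 * m}}" for x
  have KA: "K x \<subseteq> A" for x using private_nbrs_subset by (auto simp: K_def)
  have finX0: "finite X0" using X0(1) by (rule finite_subset) simp
  define P where "P = (SIGMA x:X0. K x)"
  define F where "F = (\<lambda>(x, a). {x, a}) ` P"
  \<comment> \<open>Centres move by \<open>g\<close> into \<open>Y\<close> and leaves by the
    translation into \<open>B\<close>. These intervals are disjoint, so the map is injective on
    \<open>X0\<close> together with \<open>A\<close>.\<close>
  define \<phi> where "\<phi> = (\<lambda>v. if v \<in> A then v + 2 * m else g v)"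
  have mem: "x \<in> X" "x \<in> X0" "a \<in> A" "x \<notin> A" "g x \<in> Y" "b {x, a}" "b {g x, a + 2 * m}" if "(x, a) \<in> P" for x a
  proof -
    show "x \<in> X0" "x \<in> X" using that X0(1) by (auto simp: P_def)
    then show "x \<notin> A" by (auto simp: X_def A_def)
    show "a \<in> A" "b {x, a}" "b {g x, a + 2 * m}"
      using that KA by (auto simp: P_def K_def private_nbrs_def)
    show "g x \<in> Y" using \<open>x \<in> X0\<close> X0(3) by auto
  qed
  have \<phi>F: "(`) \<phi> ` F = (\<lambda>(x, a). {g x, a + 2 * m}) ` P"
    unfolding F_def image_image by (intro image_cong) (auto simp: \<phi>_def mem)
  have inj: "inj_on (\<lambda>(x, a). {x, a}) P"
  proof (rule inj_onI, clarify)
    fix x a x' a' assume h: "(x, a) \<in> P" "(x', a') \<in> P" "{x, a} = {x', a'}"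
    then show "x = x' \<and> a = a'" using edge_eq_XA[of x x' a a'] mem[OF h(1)] mem[OF h(2)] by simp
  qed
  have "k * card X0 \<le> (\<Sum>x\<in>X0. card (K x))"
  proof -
    have "(\<Sum>x\<in>X0. k) \<le> (\<Sum>x\<in>X0. card (K x))"
      using X0(4) by (intro sum_mono) (auto simp: good_def K_def)
    then show ?thesis by (simp add: mult.commute)
  qed
  also have "\<dots> = card P"
    unfolding P_def using finX0 KA finite_subset[OF _ finite_sets(3)] by (intro card_SigmaI[symmetric]) auto
  also have "\<dots> = card F" unfolding F_def by (rule card_image[OF inj, symmetric])
  also have "\<dots> \<le> ISO (graph_of_bits n b)"
    unfolding graph_of_bits_def
  proof (rule ISO_ge_card[where U = "X0 \<union> A" and \<phi> = \<phi>])
    have disj: "x \<notin> A" "g x \<in> Y" if "x \<in> X0" for x using that X0 by (auto simp: X_def A_def)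
    show "inj_on \<phi> (X0 \<union> A)"
    proof (rule inj_onI)
      fix u v assume uv: "u \<in> X0 \<union> A" "v \<in> X0 \<union> A" "\<phi> u = \<phi> v"
      have ne: "g x \<noteq> a + 2 * m" if "x \<in> X0" "a \<in> A" for x a
        using disj(2)[OF that(1)] that(2) by (auto simp: A_def Y_def)
      show "u = v"
        using uv ne disj(1) X0(2) by (auto simp: \<phi>_def inj_on_eq_iff split: if_splits) (metis ne)
    qed
    show "\<phi> ` (X0 \<union> A) \<subseteq> {1..n}"
    proof (rule image_subsetI)
      fix v assume "v \<in> X0 \<union> A"
      then have "\<phi> v \<in> Y \<or> \<phi> v \<in> {3 * m + 1..4 * m}" using disj by (auto simp: \<phi>_def A_def)
      then show "\<phi> v \<in> {1..n}" using m_le by (auto simp: Y_def)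
    qed
    show "X0 \<union> A \<subseteq> {1..n}" using X0(1) m_le by (auto simp: X_def A_def)
    show "F \<subseteq> {e \<in> pairs {1..n}. b e}"
      using mem edge_in_I(1) unfolding F_def I_def by fastforce
    show "(`) \<phi> ` F \<subseteq> {e \<in> pairs {1..n}. b e}"
      unfolding \<phi>F using mem edge_in_I(2) unfolding I_def by fastforce
    show "F \<subseteq> pairs (X0 \<union> A)" unfolding F_def using mem by fastforce
    have "F \<subseteq> XA" unfolding F_def XA_def using mem by fastforce
    moreover have "(`) \<phi> ` F \<inter> XA = {}" unfolding \<phi>F using edge_YB_notin_XA mem by fastforce
    ultimately show "F \<inter> (`) \<phi> ` F = {}" by blast
  qed simp
  finally show ?thesis .
qed

text \<open>Whether a is a private neighbour of \<open>x\<close> depends only on the edges between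
  \<open>X\<close> and a, so the events are independent over a. Each requires one edge and at most L
  non-edges, and the Chernoff bound applies.\<close>

lemma bit_prob_few_private_nbrs:
  defines "q \<equiv> p * (1 - p) ^ L"
  assumes "x \<in> X"
  shows "bit_prob I p (\<lambda>b. real (card (private_nbrs b x)) \<le> q * m / 4) \<le> exp (- q * m / 4)"
proof -
  define Bx where "Bx = {x' \<in> X. block x' = block x} - {x}"
  define Q where "Q a b \<longleftrightarrow> (\<forall>e\<in>{{x, a}}. b e) \<and> (\<forall>e\<in>(\<lambda>x'. {x', a}) ` Bx. \<not> b e)" for a b
  define S where "S a = (\<lambda>x'. {x', a}) ` X" for a
  have "bit_prob I p (\<lambda>b. real (card {a \<in> A. Q a b}) \<le> q * card A / 4) \<le> exp (- q * card A / 4)"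
  proof (rule bit_prob_Chernoff[where S = S])
    show "disjoint_family_on S A"
      using edge_eq_XA by (fastforce simp: disjoint_family_on_def S_def)
    fix a assume a: "a \<in> A"
    show "depends_on (Q a) (S a)"
      unfolding depends_on_def Q_def S_def Bx_def using assms(2) by auto
    have inj: "inj_on (\<lambda>x'. {x', a}) Bx" using edge_eq_XA a by (auto simp: inj_on_def Bx_def)
    have "card Bx \<le> card {x' \<in> X. block x' = block x}" unfolding Bx_def by (intro card_mono) auto
    also have "\<dots> \<le> L" by (rule card_block_le)
    finally have "card Bx \<le> L" .
    have "q \<le> p * (1 - p) ^ card Bx"
      unfolding q_def using p \<open>card Bx \<le> L\<close> by (intro mult_left_mono power_decreasing) auto
    also have "\<dots> = p ^ card {{x, a}} * (1 - p) ^ card ((\<lambda>x'. {x', a}) ` Bx)"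
      by (simp add: card_image[OF inj])
    also have "\<dots> = bit_prob I p (Q a)"
      unfolding Q_def
    proof (rule bit_prob_ones_zeros[symmetric])
      show "{{x, a}} \<inter> (\<lambda>x'. {x', a}) ` Bx = {}"
        using edge_eq_XA[OF assms(2) _ a a] by (auto simp: Bx_def)
      show "{{x, a}} \<subseteq> I" "(\<lambda>x'. {x', a}) ` Bx \<subseteq> I" using edge_in_I(1) a assms(2) by (auto simp: Bx_def)
    qed (use p in auto)
    finally show "q \<le> bit_prob I p (Q a)" .
  qed auto
  moreover have "{a \<in> A. Q a b} = private_nbrs b x" for b
    by (auto simp: Q_def private_nbrs_def Bx_def)
  ultimately show ?thesis by simp
qed

text \<open>\<open>Z\<close> is confined to one block because private neighbourhoods are disjoint
  only there; half a block still leaves enough independent trials.\<close>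

definition dense_pairs :: "(nat set \<times> nat set) set" where
  "dense_pairs = {(Z, Y'). Z \<subseteq> X \<and> Y' \<subseteq> Y \<and> (\<forall>x\<in>Z. \<forall>x'\<in>Z. block x = block x') \<and>
     L \<le> 2 * card Z \<and> m \<le> 2 * card Y'}"

lemma finite_dense_pairs: "finite dense_pairs" and card_dense_pairs: "card dense_pairs \<le> 4 ^ m"
proof -
  have sub: "dense_pairs \<subseteq> Pow X \<times> Pow Y" by (auto simp: dense_pairs_def)
  then show "finite dense_pairs" by (rule finite_subset) simp
  have "card dense_pairs \<le> card (Pow X \<times> Pow Y)" using sub by (intro card_mono) auto
  also have "\<dots> = 4 ^ m" by (simp add: card_cartesian_product card_Pow power_mult_distrib[symmetric])
  finally show "card dense_pairs \<le> 4 ^ m" .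
qed

text \<open>With the bits in \<open>XA\<close> frozen, the event for (x, y) inspects only the edges
  from y to the translates of the private neighbours of x. These edge sets are disjoint: for
  different y obviously, for the same y because the private neighbourhoods are. Each trial fails
  with probability at most 1 - q <= exp (- q), and there are at least L m / 4 of them.\<close>

lemma bit_prob_no_good_pair:
  fixes q :: real
  assumes "k \<le> d" "q \<le> (real d / real k) ^ k * p ^ k * (1 - p) ^ d" "0 \<le> q"
    and b0: "\<forall>x\<in>X. d \<le> card (private_nbrs b0 x)" and t: "(Z, Y') \<in> dense_pairs"
  shows "bit_prob I p (\<lambda>b. \<forall>x\<in>Z. \<forall>y\<in>Y'. \<not> good k (merge_bits XA b0 b) x y) \<le> exp (- q * L * m / 4)"
proof -
  have Z: "Z \<subseteq> X" "Y' \<subseteq> Y" "\<And>x x'. x \<in> Z \<Longrightarrow> x' \<in> Z \<Longrightarrow> block x = block x'" "L \<le> 2 * card Z" "m \<le> 2 * card Y'"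
    using t unfolding dense_pairs_def mem_Collect_eq prod.case by blast+
  have fin: "finite (Z \<times> Y')"
    using finite_subset[OF Z(1)] finite_subset[OF Z(2)] by simp
  define S where "S = (\<lambda>(x, y). (\<lambda>a. {y, a + 2 * m}) ` private_nbrs b0 x)"
  define Q where "Q z b \<longleftrightarrow> \<not> k \<le> card {e \<in> S z. b e}" for z b
  have good: "good k (merge_bits XA b0 b) x y \<longleftrightarrow> \<not> Q (x, y) b" if "x \<in> X" "y \<in> Y" for x y b
  proof -
    have 1: "private_nbrs (merge_bits XA b0 b) x = private_nbrs b0 x"
      by (rule private_nbrs_cong[OF that(1)]) (simp add: merge_bits_def)
    have 2: "merge_bits XA b0 b {y, a + 2 * m} = b {y, a + 2 * m}" if "a \<in> A" for a
      using edge_YB_notin_XA[OF \<open>y \<in> Y\<close> that] by (simp add: merge_bits_def)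
    have "{e \<in> S (x, y). b e} = (\<lambda>a. {y, a + 2 * m}) ` {a \<in> private_nbrs b0 x. b {y, a + 2 * m}}"
      by (auto simp: S_def)
    moreover have "inj_on (\<lambda>a. {y, a + 2 * m}) {a \<in> private_nbrs b0 x. b {y, a + 2 * m}}"
      using edge_eq_YB[OF that(2) that(2)] private_nbrs_subset[of b0 x] by (auto simp: inj_on_def)
    moreover have "{a \<in> private_nbrs b0 x. merge_bits XA b0 b {y, a + 2 * m}} =
        {a \<in> private_nbrs b0 x. b {y, a + 2 * m}}"
      using 2 private_nbrs_subset[of b0 x] by blast
    ultimately show ?thesis by (simp add: good_def Q_def 1 card_image)
  qed
  have "bit_prob I p (\<lambda>b. \<forall>x\<in>Z. \<forall>y\<in>Y'. \<not> good k (merge_bits XA b0 b) x y) = bit_prob I p (\<lambda>b. \<forall>z\<in>Z \<times> Y'. Q z b)"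
  proof -
    have "(\<forall>x\<in>Z. \<forall>y\<in>Y'. \<not> good k (merge_bits XA b0 b) x y) \<longleftrightarrow> (\<forall>z\<in>Z \<times> Y'. Q z b)" for b
      using good Z(1,2) by blast
    then show ?thesis by simp
  qed
  also have "\<dots> = (\<Prod>z\<in>Z \<times> Y'. bit_prob I p (Q z))"
  proof (rule bit_prob_Ball[where S = S, OF _ fin])
    show "depends_on (Q z) (S z)" for z
    proof -
      have "Q z b = Q z b'" if "\<forall>e\<in>S z. b e = b' e" for b b'
      proof -
        have "{e \<in> S z. b e} = {e \<in> S z. b' e}" using that by auto
        then show ?thesis by (simp only: Q_def)
      qed
      then show ?thesis unfolding depends_on_def by blast
    qed
    show "disjoint_family_on S (Z \<times> Y')"
      unfolding disjoint_family_on_def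
    proof (intro ballI impI)
      fix z z' assume z: "z \<in> Z \<times> Y'" "z' \<in> Z \<times> Y'" "z \<noteq> z'"
      obtain x y x' y' where eq: "z = (x, y)" "z' = (x', y')" by (cases z, cases z')
      have mem: "x \<in> Z" "x' \<in> Z" "y \<in> Y" "y' \<in> Y" using z eq Z by auto
      show "S z \<inter> S z' = {}"
      proof (rule ccontr)
        assume "S z \<inter> S z' \<noteq> {}"
        then obtain a a' where a: "a \<in> private_nbrs b0 x" "a' \<in> private_nbrs b0 x'"
          "{y, a + 2 * m} = {y', a' + 2 * m}" by (auto simp: S_def eq)
        then have "y = y'" "a = a'"
          using edge_eq_YB[OF mem(3,4), of a a'] private_nbrs_subset by blast+
        then have "private_nbrs b0 x \<inter> private_nbrs b0 x' \<noteq> {}" "x \<noteq> x'"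
          using a(1,2) z(3) eq by auto
        moreover have "x \<in> X" "x' \<in> X" "block x = block x'" using Z(1) Z(3)[OF mem(1,2)] mem(1,2) by auto
        ultimately show False using private_nbrs_disjoint[of x x' b0] by simp
      qed
    qed
  qed simp
  also have "\<dots> \<le> (\<Prod>z\<in>Z \<times> Y'. exp (- q))"
  proof (rule prod_mono, safe)
    fix x y assume xy: "x \<in> Z" "y \<in> Y'"
    then have mem: "x \<in> X" "y \<in> Y" using Z by auto
    have SI: "S (x, y) \<subseteq> I" using edge_in_I(2)[OF mem(2)] private_nbrs_subset[of b0 x] by (auto simp: S_def)
    have "inj_on (\<lambda>a. {y, a + 2 * m}) (private_nbrs b0 x)"
      using edge_eq_YB[OF mem(2) mem(2)] private_nbrs_subset[of b0 x] by (auto simp: inj_on_def)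
    then have "card (S (x, y)) = card (private_nbrs b0 x)" by (simp add: S_def card_image)
    then have "d \<le> card (S (x, y))" using b0 mem by simp
    then have "q \<le> bit_prob I p (\<lambda>b. k \<le> card {e \<in> S (x, y). b e})"
      using bit_prob_card_ge[OF finite_sets(1) SI p _ assms(1)] assms(2) by simp
    moreover have "bit_prob I p (Q (x, y)) = 1 - bit_prob I p (\<lambda>b. k \<le> card {e \<in> S (x, y). b e})"
      unfolding Q_def using measure_pmf.prob_neg[where P = "\<lambda>b. k \<le> card {e \<in> S (x, y). b e}"] by simp
    ultimately show "bit_prob I p (Q (x, y)) \<le> exp (- q)"
      using exp_ge_add_one_self[of "- q"] by linarith
  qed simp
  also have "\<dots> = exp (- q * (real (card Z) * real (card Y')))"
    using exp_of_nat_mult[of "card Z * card Y'" "- q"] by (simp add: card_cartesian_product mult_ac)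
  also have "\<dots> \<le> exp (- q * (L / 2 * (m / 2)))"
  proof -
    have "real L / 2 * (real m / 2) \<le> real (card Z) * real (card Y')"
      using Z(4,5) by (intro mult_mono) auto
    from mult_left_mono[OF this assms(3)] show ?thesis by simp
  qed
  also have "\<dots> = exp (- q * L * m / 4)" by simp
  finally show ?thesis .
qed

text \<open>The two terms bound the two ways to fail: some vertex of \<open>X\<close> has fewer than
  d private neighbours, or some dense pair contains no good pair. Otherwise the greedy matching
  covers half of \<open>X\<close>, with \<open>k\<close> edges per matched vertex.\<close>

lemma bit_prob_ISO_blocks:
  fixes q q1 :: real
  defines "q1 \<equiv> p * (1 - p) ^ L"
  assumes "k \<le> d" "q \<le> (real d / real k) ^ k * p ^ k * (1 - p) ^ d" "0 \<le> q"
    and d: "real d \<le> q1 * m / 4"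
  shows "bit_prob I p (\<lambda>b. 2 * ISO (graph_of_bits n b) < k * m)
    \<le> m * exp (- q1 * m / 4) + 4 ^ m * exp (- q * L * m / 4)"
proof -
  define H where "H b \<longleftrightarrow> (\<forall>x\<in>X. d \<le> card (private_nbrs b x))" for b
  define Bad where "Bad b \<longleftrightarrow> (\<exists>t\<in>dense_pairs. \<forall>x\<in>fst t. \<forall>y\<in>snd t. \<not> good k b x y)" for b
  have "bit_prob I p (\<lambda>b. 2 * ISO (graph_of_bits n b) < k * m)
      \<le> measure_pmf.prob (bits I p) ({b. \<not> H b} \<union> {b. H b \<and> Bad b})"
  proof (rule measure_pmf.finite_measure_mono)
    have False if H: "H b" and small: "2 * ISO (graph_of_bits n b) < k * m" and nb: "\<not> Bad b" for b
    proof -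
      obtain X0 g where X0: "X0 \<subseteq> X" "inj_on g X0" "g ` X0 \<subseteq> Y" "\<And>x. x \<in> X0 \<Longrightarrow> good k b x (g x)"
        "m \<le> 2 * card X0"
      proof (rule bipartite_large_matching[of X Y m "good k b"])
        fix X' Y' assume XY: "X' \<subseteq> X" "Y' \<subseteq> Y" "m < 2 * card X'" "m < 2 * card Y'"
        obtain j where j: "L \<le> 2 * card {x \<in> X'. block x = j}" using dense_block XY by blast
        \<comment> \<open>A violation of the matching condition by \<open>X'\<close> shrinks to one
          inside a single block, which \<open>Bad\<close> excludes.\<close>
        have "({x \<in> X'. block x = j}, Y') \<in> dense_pairs" using XY j by (auto simp: dense_pairs_def)
        then show "\<exists>x\<in>X'. \<exists>y\<in>Y'. good k b x y" using nb unfolding Bad_def by fastforce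
      qed auto
      have "k * m \<le> k * (2 * card X0)" using X0(5) by simp
      also have "\<dots> \<le> 2 * ISO (graph_of_bits n b)" using ISO_ge_good_matching[OF X0(1-4)] by simp
      finally show False using small by simp
    qed
    then show "{b. 2 * ISO (graph_of_bits n b) < k * m} \<subseteq> {b. \<not> H b} \<union> {b. H b \<and> Bad b}" by blast
  qed simp
  also have "\<dots> \<le> bit_prob I p (\<lambda>b. \<not> H b) + bit_prob I p (\<lambda>b. H b \<and> Bad b)"
    by (rule measure_Un_le) auto
  also have "\<dots> \<le> m * exp (- q1 * m / 4) + 4 ^ m * exp (- q * L * m / 4)"
  proof (rule add_mono)
    have "bit_prob I p (\<lambda>b. \<not> H b) \<le> bit_prob I p (\<lambda>b. \<exists>x\<in>X. real (card (private_nbrs b x)) \<le> q1 * m / 4)"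
      by (rule bit_prob_mono) (use d in \<open>force simp: H_def not_le\<close>)
    also have "\<dots> \<le> real (card X) * exp (- q1 * m / 4)"
      unfolding q1_def by (intro bit_prob_union_bound bit_prob_few_private_nbrs) auto
    finally show "bit_prob I p (\<lambda>b. \<not> H b) \<le> m * exp (- q1 * m / 4)" by simp
    show "bit_prob I p (\<lambda>b. H b \<and> Bad b) \<le> 4 ^ m * exp (- q * L * m / 4)"
    proof (rule bit_prob_resample_le)
      show "depends_on H XA"
        unfolding depends_on_def H_def
      proof (intro allI impI ball_cong refl)
        fix b b' :: "nat set \<Rightarrow> bool" and x assume h: "\<forall>i\<in>XA. b i = b' i" "x \<in> X"
        then have "private_nbrs b x = private_nbrs b' x" by (intro private_nbrs_cong) auto
        then show "(d \<le> card (private_nbrs b x)) = (d \<le> card (private_nbrs b' x))" by simp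
      qed
      fix b0 assume "H b0"
      then have "bit_prob I p (\<lambda>b. Bad (merge_bits XA b0 b)) \<le> real (card dense_pairs) * exp (- q * L * m / 4)"
        unfolding Bad_def H_def
        by (intro bit_prob_union_bound finite_dense_pairs bit_prob_no_good_pair[OF assms(2-4)]) auto
      also have "\<dots> \<le> 4 ^ m * exp (- q * L * m / 4)"
      proof (rule mult_right_mono)
        show "real (card dense_pairs) \<le> 4 ^ m"
          using card_dense_pairs by (metis of_nat_le_iff of_nat_numeral of_nat_power)
      qed simp
      finally show "bit_prob I p (\<lambda>b. Bad (merge_bits XA b0 b)) \<le> 4 ^ m * exp (- q * L * m / 4)" .
    qed auto
  qed
  finally show ?thesis .
qed

end

section \<open>Numerical estimates and choice of the parameters\<close>

lemma one_minus_ge_exp: "0 \<le> x \<Longrightarrow> x \<le> 1 / 2 \<Longrightarrow> exp (- 2 * x) \<le> 1 - x" for x :: real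
proof -
  assume x: "0 \<le> x" "x \<le> 1 / 2"
  have "2 * x\<^sup>2 \<le> x"
    using mult_left_mono[OF x(2,1)] by (simp add: power2_eq_square)
  then have "- 2 * x \<le> ln (1 - x)"
    using ln_one_minus_pos_lower_bound[OF x] by simp
  then have "exp (- 2 * x) \<le> exp (ln (1 - x))" by simp
  then show ?thesis using x by simp
qed

text \<open>The base (d / k) p is at least ln \<gamma> / (2 \<gamma>^2), hence at least 1 /
  \<gamma>^2, so its k-th power is at least exp (- ln n / 10). Moreover (1 - p)^d >= exp (- 2 p d)
  >= exp (- ln n / 15). Finally 1/10 + 1/15 = 1/6.\<close>

lemma binomial_lower_estimate:
  fixes n p \<gamma> :: real
  assumes p: "0 < p" "p \<le> 1 / 2" "p\<^sup>2 * n = ln n / \<gamma>\<^sup>2" and n: "1 \<le> ln n" "0 < n"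
    and \<gamma>: "1 \<le> \<gamma>" "2 \<le> ln \<gamma>"
    and k: "0 < k" "real k \<le> ln n / (20 * ln \<gamma>)" and d: "p * n / 40 \<le> real d" "real d \<le> p * n / 30"
  shows "exp (- ln n / 6) \<le> (real d / real k) ^ k * p ^ k * (1 - p) ^ d"
proof -
  have "exp (- ln n / 10) \<le> (real d / real k * p) ^ k"
  proof -
    have "1 / \<gamma>\<^sup>2 \<le> real d / real k * p"
    proof -
      have "real k / \<gamma>\<^sup>2 \<le> ln n / (20 * ln \<gamma>) / \<gamma>\<^sup>2" by (intro divide_right_mono k) simp
      also have "\<dots> = (p\<^sup>2 * n) / (20 * ln \<gamma>)" by (simp add: p(3))
      also have "\<dots> \<le> (p\<^sup>2 * n) / 40"
        using \<gamma>(2) n by (intro divide_left_mono mult_pos_pos; (linarith | simp))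
      also have "\<dots> = p * n / 40 * p" by (simp add: power2_eq_square)
      also have "\<dots> \<le> real d * p" using d p by (intro mult_right_mono) auto
      finally show ?thesis using k by (simp add: field_simps)
    qed
    moreover have "1 / \<gamma>\<^sup>2 = exp (- 2 * ln \<gamma>)"
      using \<gamma> exp_of_nat_mult[of 2 "- ln \<gamma>"] by (simp add: exp_minus field_simps)
    ultimately have "exp (- 2 * ln \<gamma>) ^ k \<le> (real d / real k * p) ^ k" by (intro power_mono) auto
    moreover have "exp (- 2 * ln \<gamma>) ^ k = exp (real k * (- 2 * ln \<gamma>))" by (simp only: exp_of_nat_mult)
    moreover have "- ln n / 10 \<le> real k * (- 2 * ln \<gamma>)"
    proof -
      have "real k * (20 * ln \<gamma>) \<le> ln n"
        by (rule pos_le_divide_eq[THEN iffD1, OF _ k(2)]) (use \<gamma>(2) in linarith)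
      then show ?thesis by simp
    qed
    ultimately show ?thesis by (smt (verit) exp_le_cancel_iff)
  qed
  moreover have "exp (- ln n / 15) \<le> (1 - p) ^ d"
  proof -
    have "p * real d \<le> p * (p * n / 30)" using d p by (intro mult_left_mono) auto
    also have "\<dots> = ln n / \<gamma>\<^sup>2 / 30" unfolding p(3)[symmetric] by (simp add: power2_eq_square)
    also have "\<dots> \<le> ln n / 1 / 30"
    proof (intro divide_right_mono frac_le)
      show "1 \<le> \<gamma>\<^sup>2" using \<gamma>(1) by (rule one_le_power)
    qed (use n(1) in linarith)+
    finally have "- ln n / 15 \<le> real d * (- 2 * p)" by (simp add: mult.commute)
    then have "exp (- ln n / 15) \<le> exp (- 2 * p) ^ d" unfolding exp_of_nat_mult[symmetric] by simp
    also have "\<dots> \<le> (1 - p) ^ d" using one_minus_ge_exp[of p] p by (intro power_mono) auto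
    finally show ?thesis .
  qed
  ultimately have "exp (- ln n / 10) * exp (- ln n / 15) \<le> (real d / real k * p) ^ k * (1 - p) ^ d"
    using p by (intro mult_mono) auto
  then show ?thesis by (simp only: power_mult_distrib exp_add[symmetric]) simp
qed

lemma eventually_ISO_dense:
  "\<forall>\<^sub>F n in sequentially. \<forall>p \<gamma>. 0 < p \<and> p \<le> 1 \<and> \<gamma> = 1 / p * sqrt (ln (real n) / real n) \<and>
       exp 6 \<le> \<gamma> \<and> \<gamma> \<le> real n powr (1 / 20) \<longrightarrow>
     bit_prob (pairs {1..n}) p (\<lambda>b. real (ISO (graph_of_bits n b)) < real n * ln (real n) / (400 * ln \<gamma>))
       \<le> 1 / real n"
proof -
  have "\<forall>\<^sub>F n in sequentially. real n powr (1/5) * sqrt (ln (real n) / real n) \<le> 1 / 10"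
    "\<forall>\<^sub>F n in sequentially. 120 \<le> real n powr (9/20)"
    "\<forall>\<^sub>F n in sequentially. 1 \<le> ln (real n)"
    "\<forall>\<^sub>F n in sequentially. ln (real n) \<le> real n powr (9/20) / 40"
    "\<forall>\<^sub>F n in sequentially. 12 \<le> exp (- ln (real n) / 6) * (real n powr (1/5) - 1)"
    "\<forall>\<^sub>F n in sequentially. real n / 5 \<le> real n / 4 - real n powr (1/5)"
    "\<forall>\<^sub>F n in sequentially. real n * exp (- (45 / 1000) * real n powr (9/20)) \<le> 1 / (2 * real n)"
    "\<forall>\<^sub>F n in sequentially. exp (- real n / 5) \<le> 1 / (2 * real n)"
    "\<forall>\<^sub>F n in sequentially. sqrt (ln (real n) / real n) \<le> 1 / 2"
    by real_asymp+
  then show ?thesis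
    using eventually_gt_at_top[of 1]
  proof eventually_elim
    case (elim n)
    note E = elim(1-9)
    have n1: "1 < real n" using elim(10) by simp
    define l where "l = ln (real n)"
    have l1: "1 \<le> l" using E(3) by (simp add: l_def)
    show ?case
    proof (intro allI impI, elim conjE)
      fix p \<gamma> :: real
      assume p0: "0 < p" and p1: "p \<le> 1" and \<gamma>_def: "\<gamma> = 1 / p * sqrt (ln (real n) / real n)"
        and \<gamma>6: "exp 6 \<le> \<gamma>" and \<gamma>n: "\<gamma> \<le> real n powr (1 / 20)"
      have \<gamma>1: "1 \<le> \<gamma>" using \<gamma>6 one_le_exp_iff[of "6::real"] by linarith
      have s6: "6 \<le> ln \<gamma>" using \<gamma>6 \<gamma>1 by (simp add: ln_ge_iff)
      have "ln \<gamma> \<le> ln (real n powr (1 / 20))" using \<gamma>n \<gamma>1 by (intro ln_mono) auto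
      then have sl: "ln \<gamma> \<le> l / 20" using n1 by (simp add: ln_powr l_def)
      have p_eq: "p * \<gamma> = sqrt (l / n)" using p0 by (simp add: \<gamma>_def l_def)
      have p2: "p\<^sup>2 * n = l / \<gamma>\<^sup>2"
      proof -
        have "(p * \<gamma>)\<^sup>2 = l / n" unfolding p_eq using l1 n1 by simp
        then show ?thesis using n1 \<gamma>1 by (simp add: power_mult_distrib field_simps)
      qed
      have p_le: "p \<le> sqrt (l / n)"
        unfolding p_eq[symmetric] using p0 \<gamma>1 by (simp add: mult_left_mono)
      have p_half: "p \<le> 1 / 2" using p_le E(9) by (simp add: l_def)
      \<comment> \<open>Since p n = sqrt (n ln n) / \<gamma> and \<gamma> <= n^(1/20), the exponent
        is 1/2 - 1/20 = 9/20.\<close>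
      have pn: "real n powr (9/20) \<le> p * n"
      proof -
        have "1 \<le> sqrt l" using l1 by simp
        from mult_right_mono[OF this, of "sqrt n"] have "sqrt n \<le> sqrt l * sqrt n" by simp
        also have "\<dots> = sqrt (l / n) * n" using n1 by (simp add: real_sqrt_divide field_simps)
        also have "\<dots> = \<gamma> * (p * n)" using p_eq by (simp add: mult_ac)
        also have "\<dots> \<le> real n powr (1/20) * (p * n)" using \<gamma>n p0 by (intro mult_right_mono) auto
        finally have "real n powr (1/2) \<le> real n powr (1/20) * (p * n)" using n1 by (simp add: powr_half_sqrt)
        moreover have "real n powr (1/2) = real n powr (1/20) * real n powr (9/20)"
          by (simp add: powr_add[symmetric])
        ultimately show ?thesis using n1 by simp
      qed
      \<comment> \<open>The block length n^(1/5) must outgrow 1 / q = n^(1/6), yet be small against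
        1 / p, so that (1 - p)^L stays above 9/10.\<close>
      define L where "L = nat \<lfloor>real n powr (1/5)\<rfloor>"
      have "1 \<le> real n powr (1/5)" using n1 by (simp add: ge_one_powr_ge_zero)
      then have Lb: "real L \<le> real n powr (1/5)" "real n powr (1/5) - 1 \<le> real L" "0 < L"
        unfolding L_def by linarith+
      define M where "M = n div (4 * L)"
      have "4 * (L * M) \<le> n" unfolding M_def by (metis mult.assoc times_div_less_eq_dividend)
      then interpret block_layout n L M p
        using p0 p1 Lb(3) by unfold_locales auto
      have m: "real n / 5 \<le> real m" "real m \<le> real n"
      proof -
        have "n < 4 * L * M + 4 * L"
          using dividend_less_times_div[of "4 * L" n] Lb(3) unfolding M_def by simp
        then have "real n < real (4 * L * M + 4 * L)" by (simp only: of_nat_less_iff)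
        then have "real n < 4 * real m + 4 * real L" by (simp add: m_def)
        then show "real n / 5 \<le> real m" using Lb(1) E(6) by linarith
        show "real m \<le> real n" using m_le by linarith
      qed
      define q1 where "q1 = p * (1 - p) ^ L"
      \<comment> \<open>45/1000 is 9/10 from (1 - p)^L, times 1/5 from m >= n / 5, times
        1/4.\<close>
      have q1: "45 / 1000 * (p * n) \<le> q1 * m / 4"
      proof -
        have "real L * p \<le> real n powr (1/5) * sqrt (l / n)" using Lb(1) p_le p0 by (intro mult_mono) auto
        then have "9 / 10 \<le> 1 + real L * (- p)" using E(1) by (simp add: l_def)
        also have "\<dots> \<le> (1 + (- p)) ^ L" by (rule Bernoulli_inequality) (use p1 in simp)
        finally have "9 / 10 \<le> (1 - p) ^ L" by simp
        then have "p * (9 / 10) * (real n / 5) \<le> q1 * m"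
          unfolding q1_def using p0 m p1 by (intro mult_mono) auto
        then show ?thesis by simp
      qed
      have pn120: "120 \<le> p * n" using pn E(2) by linarith
      \<comment> \<open>p n / 40 lies below the guaranteed 0.045 p n private neighbours; p n >= 120
        absorbs the rounding by one.\<close>
      define d where "d = nat \<lceil>p * n / 40\<rceil>"
      have d: "p * n / 40 \<le> real d" "real d \<le> p * n / 40 + 1" using pn120 unfolding d_def by linarith+
      then have d': "real d \<le> p * n / 30" using pn120 by linarith
      define k where "k = nat \<lfloor>l / (20 * ln \<gamma>)\<rfloor>"
      \<comment> \<open>Here \<gamma> <= n^(1/20) is needed: the quotient is at least 1, so its
        floor is positive and loses at most a factor 2.\<close>
      have "1 \<le> l / (20 * ln \<gamma>)" using sl s6 by (simp add: le_divide_eq)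
      then have k: "0 < k" "real k \<le> l / (20 * ln \<gamma>)" "l / (20 * ln \<gamma>) / 2 \<le> real k"
      proof -
        have "0 < nat \<lfloor>z\<rfloor> \<and> real (nat \<lfloor>z\<rfloor>) \<le> z \<and> z / 2 \<le> real (nat \<lfloor>z\<rfloor>)" if "1 \<le> z" for z :: real
        proof -
          have "1 \<le> \<lfloor>z\<rfloor>" using that by simp
          then have "real (nat \<lfloor>z\<rfloor>) = of_int \<lfloor>z\<rfloor>" "1 \<le> (of_int \<lfloor>z\<rfloor> :: real)" by simp_all
          then show ?thesis using \<open>1 \<le> \<lfloor>z\<rfloor>\<close> by (auto, linarith+)
        qed
        from this[OF \<open>1 \<le> l / (20 * ln \<gamma>)\<close>]
        show "0 < k" "real k \<le> l / (20 * ln \<gamma>)" "l / (20 * ln \<gamma>) / 2 \<le> real k"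
          unfolding k_def by blast+
      qed
      have "k \<le> d"
      proof -
        have "l / (20 * ln \<gamma>) \<le> l / 1" using s6 l1 by (intro divide_left_mono) auto
        also have "\<dots> \<le> real n powr (9/20) / 40" using E(4) by (simp add: l_def)
        also have "\<dots> \<le> real d" using pn d by linarith
        finally show ?thesis using k(2) by linarith
      qed
      define q where "q = exp (- l / 6)"
      have q: "q \<le> (real d / real k) ^ k * p ^ k * (1 - p) ^ d"
        unfolding q_def l_def
        by (rule binomial_lower_estimate[where \<gamma> = \<gamma>])
          (use p0 p_half p2 l1 n1 \<gamma>1 s6 k d d' in \<open>auto simp: l_def\<close>)
      have "bit_prob (pairs {1..n}) p (\<lambda>b. real (ISO (graph_of_bits n b)) < real n * ln (real n) / (400 * ln \<gamma>))
          \<le> bit_prob (pairs {1..n}) p (\<lambda>b. 2 * ISO (graph_of_bits n b) < k * m)"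
      proof (rule bit_prob_mono)
        fix b assume *: "real (ISO (graph_of_bits n b)) < real n * ln (real n) / (400 * ln \<gamma>)"
        have "2 * (real n * ln (real n) / (400 * ln \<gamma>)) = l / (20 * ln \<gamma>) / 2 * (real n / 5)"
          by (simp add: l_def)
        also have "\<dots> \<le> real k * real m" using k(3) m(1) by (intro mult_mono) auto
        finally have "real (2 * ISO (graph_of_bits n b)) < real (k * m)" using * by simp
        then show "2 * ISO (graph_of_bits n b) < k * m" by (simp only: of_nat_less_iff)
      qed
      also have "\<dots> \<le> real m * exp (- q1 * m / 4) + 4 ^ m * exp (- q * L * m / 4)"
        unfolding q1_def I_def[symmetric]
      proof (rule bit_prob_ISO_blocks[OF \<open>k \<le> d\<close> q])
        show "real d \<le> p * (1 - p) ^ L * real m / 4" using q1 d pn120 unfolding q1_def by linarith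
      qed (simp add: q_def)
      also have "\<dots> \<le> 1 / (2 * real n) + 1 / (2 * real n)"
      proof (rule add_mono)
        have "real m * exp (- q1 * m / 4) \<le> real n * exp (- (45 / 1000) * real n powr (9/20))"
          using m(2) q1 pn by (intro mult_mono) auto
        also have "\<dots> \<le> 1 / (2 * real n)" by (rule E(7))
        finally show "real m * exp (- q1 * m / 4) \<le> 1 / (2 * real n)" .
        have "12 \<le> q * L"
        proof -
          have "q * (real n powr (1/5) - 1) \<le> q * L" by (rule mult_left_mono[OF Lb(2)]) (simp add: q_def)
          then show ?thesis using E(5) unfolding q_def l_def by linarith
        qed
        \<comment> \<open>q L m / 4 >= 3 m beats the 4^m <= exp (2 m) dense pairs and leaves exp (-
          m).\<close>
        have "(4::real) \<le> exp 2"
          using exp_lower_Taylor_quadratic[of "2::real"] by simp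
        then have "4 ^ m * exp (- q * L * m / 4) \<le> exp 2 ^ m * exp (- 3 * real m)"
          using mult_right_mono[OF \<open>12 \<le> q * L\<close>, of "real m"] by (intro mult_mono power_mono) auto
        also have "\<dots> = exp (- real m)"
          unfolding exp_of_nat_mult[symmetric] exp_add[symmetric] by simp
        also have "\<dots> \<le> exp (- real n / 5)" using m by simp
        also have "\<dots> \<le> 1 / (2 * real n)" by (rule E(8))
        finally show "4 ^ m * exp (- q * L * m / 4) \<le> 1 / (2 * real n)" .
      qed
      also have "\<dots> = 1 / real n" by simp
      finally show "bit_prob (pairs {1..n}) p (\<lambda>b. real (ISO (graph_of_bits n b)) < real n * ln (real n) / (400 * ln \<gamma>))
          \<le> 1 / real n" .
    qed
  qed
qed

section \<open>Assembly of the two regimes\<close>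

lemma aas_Theta_ISO_I:
  fixes p f :: "nat \<Rightarrow> real"
  assumes "0 < c1" "0 < c2"
    and low: "\<forall>\<^sub>F n in sequentially.
      bit_prob (pairs {1..n}) (p n) (\<lambda>b. real (ISO (graph_of_bits n b)) < c1 * f n) \<le> 1 / real n"
    and upp: "\<forall>\<^sub>F n in sequentially.
      bit_prob (pairs {1..n}) (p n) (\<lambda>b. c2 * f n \<le> real (ISO (graph_of_bits n b))) \<le> 1 / real n"
  shows "aas_Theta (\<lambda>n. random_graph n (p n)) (\<lambda>G. real (ISO G)) f"
proof -
  define P where "P n = measure_pmf.prob (random_graph n (p n))
     {G. c1 * f n \<le> real (ISO G) \<and> real (ISO G) \<le> c2 * f n}" for n
  have "P \<longlonglongrightarrow> 1"
  proof (rule tendsto_sandwich)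
    show "(\<lambda>n. 1 - 2 / real n) \<longlonglongrightarrow> 1" by real_asymp
    show "\<forall>\<^sub>F n in sequentially. 1 - 2 / real n \<le> P n"
      using low upp
    proof eventually_elim
      case (elim n)
      let ?B = "bits (pairs {1..n}) (p n)" and ?X = "\<lambda>b. real (ISO (graph_of_bits n b))"
      have rg: "random_graph n (p n) = map_pmf (graph_of_bits n) ?B"
        unfolding random_graph_def bits_def graph_of_bits_def ..
      have "P n = measure_pmf.prob ?B {b. c1 * f n \<le> ?X b \<and> ?X b \<le> c2 * f n}"
        unfolding P_def rg by (simp add: vimage_def)
      moreover have "1 \<le> measure_pmf.prob ?B ({b. c1 * f n \<le> ?X b \<and> ?X b \<le> c2 * f n} \<union>
          ({b. ?X b < c1 * f n} \<union> {b. c2 * f n \<le> ?X b}))"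
      proof -
        have "{b. c1 * f n \<le> ?X b \<and> ?X b \<le> c2 * f n} \<union> ({b. ?X b < c1 * f n} \<union> {b. c2 * f n \<le> ?X b}) = UNIV"
          by auto
        then show ?thesis by simp
      qed
      moreover have "\<dots> \<le> measure_pmf.prob ?B {b. c1 * f n \<le> ?X b \<and> ?X b \<le> c2 * f n} +
          (measure_pmf.prob ?B {b. ?X b < c1 * f n} + measure_pmf.prob ?B {b. c2 * f n \<le> ?X b})"
        by (intro order_trans[OF measure_Un_le] add_left_mono) auto
      ultimately show ?case using elim by simp
    qed
  qed (auto simp: P_def)
  then show ?thesis
    unfolding aas_Theta_def aas_def P_def using assms(1,2) by blast
qed

lemma exp_le_inverse: "1 \<le> a \<Longrightarrow> 0 < n \<Longrightarrow> exp (- a * ln (real n)) \<le> 1 / real n"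
proof -
  assume "1 \<le> a" "0 < n"
  then have "exp (- a * ln (real n)) \<le> exp (- ln (real n))"
    using mult_right_mono[of 1 a "ln (real n)"] by simp
  also have "\<dots> = 1 / real n" using \<open>0 < n\<close> by (simp add: exp_minus field_simps)
  finally show ?thesis .
qed

lemma aas_Theta_ISO_sparse:
  fixes p \<gamma> :: "nat \<Rightarrow> real"
  assumes p1: "\<And>n. p n \<le> 1" and gamma: "\<And>n. \<gamma> n = 1 / p n * sqrt (ln (real n) / real n)"
    and range: "\<forall>\<^sub>F n in sequentially. 1 / (2 * real n) \<le> p n \<and> p n \<le> 1 / exp 6 * sqrt (ln (real n) / real n)"
  shows "aas_Theta (\<lambda>n. random_graph n (p n)) (\<lambda>G. real (ISO G)) (\<lambda>n. real n * (ln (real n) / ln (\<gamma> n)))"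
\<comment> \<open>1/8000 is 1/400 times 1/20: for \<gamma> > n^(1/20) the ratio ln n / ln \<gamma>
  is at most 20, so the linear bound n / 400 suffices.\<close>
proof (rule aas_Theta_ISO_I[where ?c1.0 = "1 / 8000" and ?c2.0 = 2])
  have range': "\<forall>\<^sub>F n in sequentially. 1 < n \<and> 0 < p n \<and> 1 / (2 * real n) \<le> p n \<and> exp 6 \<le> \<gamma> n"
    using range eventually_gt_at_top[of 1]
  proof eventually_elim
    case (elim n)
    have "0 < 1 / (2 * real n)" using elim(2) by simp
    then have "0 < p n" using elim(1) by linarith
    moreover have "exp 6 * p n \<le> sqrt (ln (real n) / real n)"
      using elim(1) by (simp add: field_simps)
    ultimately show ?case using elim by (simp add: gamma le_divide_eq)
  qed
  show "\<forall>\<^sub>F n in sequentially. bit_prob (pairs {1..n}) (p n)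
      (\<lambda>b. real (ISO (graph_of_bits n b)) < 1 / 8000 * (real n * (ln (real n) / ln (\<gamma> n)))) \<le> 1 / real n"
    using range' eventually_ISO_linear eventually_ISO_dense
  proof eventually_elim
    case (elim n)
    let ?f = "real n * (ln (real n) / ln (\<gamma> n))"
    have g0: "0 < \<gamma> n" using elim(1) less_le_trans[OF exp_gt_zero] by blast
    have g6: "6 \<le> ln (\<gamma> n)" using elim(1) g0 by (simp add: ln_ge_iff)
    have f0: "0 \<le> ?f" using g6 elim(1) by simp
    show ?case
    proof (cases "\<gamma> n \<le> real n powr (1 / 20)")
      case True
      have "bit_prob (pairs {1..n}) (p n) (\<lambda>b. real (ISO (graph_of_bits n b)) < 1 / 8000 * ?f) \<le>
          bit_prob (pairs {1..n}) (p n) (\<lambda>b. real (ISO (graph_of_bits n b)) < real n * ln (real n) / (400 * ln (\<gamma> n)))"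
      proof (rule bit_prob_mono)
        have "real n * ln (real n) / (400 * ln (\<gamma> n)) = 1 / 400 * ?f" by simp
        then show "real (ISO (graph_of_bits n b)) < real n * ln (real n) / (400 * ln (\<gamma> n))"
          if "real (ISO (graph_of_bits n b)) < 1 / 8000 * ?f" for b using that f0 by linarith
      qed
      also have "\<dots> \<le> 1 / real n" using elim(1,3) True gamma p1 by blast
      finally show ?thesis .
    next
      case False
      then have "ln (real n powr (1 / 20)) \<le> ln (\<gamma> n)" using elim(1) by (intro ln_mono) auto
      then have "ln (real n) \<le> 20 * ln (\<gamma> n)" using elim(1) by (simp add: ln_powr)
      then have "ln (real n) / ln (\<gamma> n) \<le> 20" using g6 by (simp add: divide_le_eq)
      then have "?f \<le> real n * 20" by (intro mult_left_mono) auto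
      then have "1 / 8000 * ?f \<le> 1 / 8000 * (real n * 20)" by (rule mult_left_mono) simp
      also have "\<dots> = real n / 400" by simp
      finally have "1 / 8000 * ?f \<le> real n / 400" .
      then have "bit_prob (pairs {1..n}) (p n) (\<lambda>b. real (ISO (graph_of_bits n b)) < 1 / 8000 * ?f) \<le>
          bit_prob (pairs {1..n}) (p n) (\<lambda>b. real (ISO (graph_of_bits n b)) < real n / 400)"
        by (intro bit_prob_mono) (rule less_le_trans)
      also have "\<dots> \<le> 1 / real n" using elim(1,2) p1 by blast
      finally show ?thesis .
    qed
  qed
  show "\<forall>\<^sub>F n in sequentially. bit_prob (pairs {1..n}) (p n)
      (\<lambda>b. 2 * (real n * (ln (real n) / ln (\<gamma> n))) \<le> real (ISO (graph_of_bits n b))) \<le> 1 / real n"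
    using range'
  proof eventually_elim
    case (elim n)
    define l where "l = ln (real n)"
    define t where "t = 2 * (real n * (l / ln (\<gamma> n)))"
    have l: "0 < l" using elim by (simp add: l_def)
    have g0: "0 < \<gamma> n" using elim less_le_trans[OF exp_gt_zero] by blast
    have g6: "6 \<le> ln (\<gamma> n)" using elim g0 by (simp add: ln_ge_iff)
    \<comment> \<open>With a = ln \<gamma> and the constant 2, the exponent n ln n - a t of the
      union bound becomes - n ln n.\<close>
    have at: "ln (\<gamma> n) * t = 2 * (real n * l)" using g6 by (simp add: t_def)
    have "bit_prob (pairs {1..n}) (p n) (\<lambda>b. t \<le> real (ISO (graph_of_bits n b)))
        \<le> exp (real n * ln n - ln (\<gamma> n) * t)"
    proof (rule bit_prob_ISO_ge)
      have "p n * \<gamma> n = sqrt (l / n)" using elim by (simp add: gamma l_def)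
      then have "(p n * \<gamma> n)\<^sup>2 = l / n" using elim l by simp
      then have "(p n)\<^sup>2 = l / (n * (\<gamma> n)\<^sup>2)" using elim g0 by (simp add: power_mult_distrib field_simps)
      then have "exp 1 * (real n)\<^sup>2 * (p n)\<^sup>2 = exp 1 * (real n * l / (\<gamma> n)\<^sup>2)"
        using elim by (simp add: power2_eq_square)
      also have "\<dots> \<le> 4 * (\<gamma> n / ln (\<gamma> n)) * (real n * l / (\<gamma> n)\<^sup>2)"
      proof (rule mult_right_mono)
        have "exp 1 * ln (\<gamma> n) \<le> 4 * \<gamma> n"
          using e_less_272 g6 ln_bound[OF g0] by (intro mult_mono) auto
        then show "exp 1 \<le> 4 * (\<gamma> n / ln (\<gamma> n))" using g6 by (simp add: le_divide_eq)
      qed (use l in simp)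
      also have "\<dots> = 2 * t * exp (- ln (\<gamma> n))"
        using g0 by (simp add: t_def exp_minus power2_eq_square field_simps)
      finally show "exp 1 * (real n)\<^sup>2 * (p n)\<^sup>2 \<le> 2 * t * exp (- ln (\<gamma> n))" .
    qed (use elim p1 g6 l in \<open>auto simp: t_def\<close>)
    also have "\<dots> = exp (- real n * ln (real n))" unfolding at l_def by simp
    also have "\<dots> \<le> 1 / real n" using elim by (intro exp_le_inverse) auto
    finally show ?case unfolding t_def l_def .
  qed
qed simp_all

lemma aas_Theta_ISO_dense:
  fixes p :: "nat \<Rightarrow> real"
  assumes p01: "\<And>n. 0 \<le> p n \<and> p n \<le> 1"
    and range: "\<forall>\<^sub>F n in sequentially. p n > 1 / exp 6 * sqrt (ln (real n) / real n)"
  shows "aas_Theta (\<lambda>n. random_graph n (p n)) (\<lambda>G. real (ISO G)) (\<lambda>n. (real n)\<^sup>2 * (p n)\<^sup>2)"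
\<comment> \<open>1/64 is a quarter of the n^2 / 16 available pairs. The factor exp 13 with a = 12
  satisfies the hypothesis of the union bound, and n^2 p^2 >= exp (- 12) n ln n gives t >= e n ln n
  >= 2 n ln n.\<close>
proof (rule aas_Theta_ISO_I[where ?c1.0 = "1 / 64" and ?c2.0 = "exp 13"])
  have range': "\<forall>\<^sub>F n in sequentially. 1 < n \<and> 0 < p n \<and> exp (- 12) * (real n * ln (real n)) \<le> (real n)\<^sup>2 * (p n)\<^sup>2"
    using range eventually_gt_at_top[of 1]
  proof eventually_elim
    case (elim n)
    have l: "0 < ln (real n)" using elim by simp
    have q0: "0 < 1 / exp 6 * sqrt (ln (real n) / real n)" using elim l by simp
    have "(1 / exp 6 * sqrt (ln (real n) / real n))\<^sup>2 \<le> (p n)\<^sup>2"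
      using elim q0 by (intro power_mono) auto
    moreover have "(1 / exp 6 * sqrt (ln (real n) / real n))\<^sup>2 = exp (- 12) * (ln (real n) / real n)"
      using l elim by (simp add: power_mult_distrib power_divide exp_double[symmetric] exp_minus field_simps)
    ultimately have "(real n)\<^sup>2 * (exp (- 12) * (ln (real n) / real n)) \<le> (real n)\<^sup>2 * (p n)\<^sup>2"
      by (intro mult_left_mono) auto
    moreover have "0 < p n" using elim(1) q0 by linarith
    ultimately show ?case using elim(2) by (simp add: power2_eq_square mult_ac)
  qed
  have "\<forall>\<^sub>F n in sequentially. 1 \<le> exp (- 12) / 64 * real n"
    "\<forall>\<^sub>F n in sequentially. (real n)\<^sup>2 / 16 \<le> (real n / 2 - 1 / 2) * (real n / 2 - 3 / 2) / 2"
    by real_asymp+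
  with range' show "\<forall>\<^sub>F n in sequentially. bit_prob (pairs {1..n}) (p n)
      (\<lambda>b. real (ISO (graph_of_bits n b)) < 1 / 64 * ((real n)\<^sup>2 * (p n)\<^sup>2)) \<le> 1 / real n"
    using eventually_ge_at_top[of 3]
  proof eventually_elim
    case (elim n)
    define N where "N = real ((n div 2) choose 2)"
    have m: "real n / 2 - 1 / 2 \<le> real (n div 2)" by linarith
    have "(real n)\<^sup>2 / 16 \<le> (real n / 2 - 1 / 2) * (real n / 2 - 3 / 2) / 2" by (rule elim(3))
    also have "\<dots> \<le> N"
      unfolding N_def real_choose_two using m elim(4) by (intro divide_right_mono mult_mono) auto
    finally have "(p n)\<^sup>2 * ((real n)\<^sup>2 / 16) \<le> (p n)\<^sup>2 * N" by (intro mult_left_mono) auto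
    then have N: "(real n)\<^sup>2 * (p n)\<^sup>2 / 64 \<le> (p n)\<^sup>2 * N / 4" by (simp add: mult.commute)
    have "bit_prob (pairs {1..n}) (p n) (\<lambda>b. real (ISO (graph_of_bits n b)) < 1 / 64 * ((real n)\<^sup>2 * (p n)\<^sup>2))
        \<le> bit_prob (pairs {1..n}) (p n) (\<lambda>b. real (ISO (graph_of_bits n b)) \<le> (p n)\<^sup>2 * N / 4)"
      by (rule bit_prob_mono) (use N in linarith)
    also have "\<dots> \<le> exp (- (p n)\<^sup>2 * N / 4)"
      unfolding N_def by (rule bit_prob_ISO_shift) (use p01 in auto)
    also have "\<dots> \<le> exp (- (exp (- 12) / 64 * real n) * ln (real n))"
    proof -
      have "exp (- 12) * (real n * ln (real n)) / 64 \<le> (p n)\<^sup>2 * N / 4"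
        using N elim(1) by linarith
      then show ?thesis by (simp add: mult_ac)
    qed
    also have "\<dots> \<le> 1 / real n" using elim(1,2) by (intro exp_le_inverse) auto
    finally show ?case .
  qed
  show "\<forall>\<^sub>F n in sequentially. bit_prob (pairs {1..n}) (p n)
      (\<lambda>b. exp 13 * ((real n)\<^sup>2 * (p n)\<^sup>2) \<le> real (ISO (graph_of_bits n b))) \<le> 1 / real n"
    using range'
  proof eventually_elim
    case (elim n)
    define t where "t = exp 13 * ((real n)\<^sup>2 * (p n)\<^sup>2)"
    have e2: "2 \<le> exp (1::real)" using exp_ge_add_one_self[of 1] by simp
    have "bit_prob (pairs {1..n}) (p n) (\<lambda>b. t \<le> real (ISO (graph_of_bits n b))) \<le> exp (real n * ln n - 12 * t)"
    proof (rule bit_prob_ISO_ge)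
      have "2 * t * exp (- 12) = 2 * (exp 1 * ((real n)\<^sup>2 * (p n)\<^sup>2))"
      proof -
        have "exp 13 * exp (- 12) = exp (1::real)" by (simp add: exp_add[symmetric])
        then show ?thesis unfolding t_def by (metis mult.assoc mult.commute)
      qed
      then show "exp 1 * (real n)\<^sup>2 * (p n)\<^sup>2 \<le> 2 * t * exp (- 12)" by (simp add: mult.assoc)
    qed (use elim p01 in \<open>auto simp: t_def\<close>)
    also have "\<dots> \<le> exp (- real n * ln (real n))"
    proof -
      have "2 * (real n * ln (real n)) \<le> exp 1 * (real n * ln (real n))"
        using e2 elim by (intro mult_right_mono) auto
      also have "\<dots> = exp 13 * (exp (- 12) * (real n * ln (real n)))"
        by (simp add: mult.assoc[symmetric] exp_add[symmetric])
      also have "\<dots> \<le> t" unfolding t_def using elim by (intro mult_left_mono) auto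
      finally have "2 * (real n * ln (real n)) \<le> t" .
      moreover have "0 \<le> t" by (simp add: t_def)
      ultimately show ?thesis by simp
    qed
    also have "\<dots> \<le> 1 / real n" using elim by (intro exp_le_inverse) auto
    finally show ?case unfolding t_def .
  qed
qed simp_all

theorem theorem1p3:
  fixes p :: "nat \<Rightarrow> real" and \<gamma> :: "nat \<Rightarrow> real"
  assumes p_prob: "\<And>n. 0 \<le> p n \<and> p n \<le> 1"
    and gamma: "\<And>n. \<gamma> n = 1 / p n * sqrt (ln (real n) / real n)"
  shows
    "((\<forall>\<^sub>F n in sequentially. 1 / (2 * real n) \<le> p n \<and>
          p n \<le> 1 / exp 6 * sqrt (ln (real n) / real n)) \<longrightarrow>
        aas_Theta (\<lambda>n. random_graph n (p n)) (\<lambda>G. real (ISO G))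
          (\<lambda>n. real n * (ln (real n) / ln (\<gamma> n)))) \<and>
     ((\<forall>\<^sub>F n in sequentially. p n > 1 / exp 6 * sqrt (ln (real n) / real n)) \<longrightarrow>
        aas_Theta (\<lambda>n. random_graph n (p n)) (\<lambda>G. real (ISO G))
          (\<lambda>n. (real n)\<^sup>2 * (p n)\<^sup>2))"
  using aas_Theta_ISO_sparse[of p \<gamma>] aas_Theta_ISO_dense[of p] p_prob gamma by blast

end
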